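(* Let $(M,g)$ be a Riemannian manifold and let $f:M\to\mathbb{R}$ be a smooth function attaining its unique minimum at a point $q\in M$. Let $\nabla^f$ be an affine connection that straightens $f$ with constant $\lambda$, i.e. $\nabla^f_{\operatorname{grad}f}\operatorname{grad}f=\lambda\operatorname{grad}f$ with $\lambda\in\mathbb{R}$ constant, and let $C^f:=\nabla^f g$ be its non-metricity tensor. Let $\gamma_1,\gamma_2:[0,\infty)\to M$ be two integral curves of the gradient descent of $f$, i.e. $\dot\gamma_i=-\operatorname{grad}f$ along $\gamma_i$, both converging to $q$ as $t\to\infty$, with $f$-equidistant initial conditions, i.e. $f(\gamma_1(0))=f(\gamma_2(0))$. Suppose that for every $t\ge 0$ such that $\|\dot\gamma_1(t)\|=\|\dot\gamma_2(t)\|$ one has $$C^f(\dot\gamma_1(t),\dot\gamma_1(t),\dot\gamma_1(t))<C^f(\dot\gamma_2(t),\dot\gamma_2(t),\dot\gamma_2(t)).$$ Then $\gamma_1$ is faster than $\gamma_2$, i.e. $f(\gamma_1(t))\le f(\gamma_2(t))$ for all $t\ge 0$.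
   Context: The Riemannian gradient is defined by $g(\operatorname{grad}f,\cdot)=\mathrm{d}f$ and $\|\cdot\|$ is the norm induced by $g$. A connection $\nabla^f$ straightens $f$ (is a straightening connection of $f$) if $\nabla^f_{\operatorname{grad}f}\operatorname{grad}f=\lambda\operatorname{grad}f$ for some real function $\lambda$; such a connection need only be defined on $M$ minus the critical points of $f$, and is not assumed flat, torsion-free or metric. Its non-metricity tensor is $C^f(W,X,Y):=(\nabla^f_W g)(X,Y)=W[g(X,Y)]-g(\nabla^f_WX,Y)-g(X,\nabla^f_WY)$, and is not assumed totally symmetric. *)

theory Defs
  imports "HOL-Analysis.Analysis"
begin

section \<open>Smooth maps between open subsets of Euclidean spaces\<close>

primrec k_smooth_on ::
  "nat \<Rightarrow> 'e::euclidean_space set \<Rightarrow> ('e \<Rightarrow> 'b::real_normed_vector) \<Rightarrow> bool" where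
  "k_smooth_on 0 S h \<longleftrightarrow> continuous_on S h"
| "k_smooth_on (Suc k) S h \<longleftrightarrow> (\<forall>x\<in>S. h differentiable (at x)) \<and>
     (\<forall>v. k_smooth_on k S (\<lambda>x. frechet_derivative h (at x) v))"

text \<open>\<open>C\<^sup>\<infinity>\<close>; only used for open \<open>S\<close>, where it depends on the values of \<open>h\<close> on \<open>S\<close> alone.\<close>

definition smooth_on ::
  "'e::euclidean_space set \<Rightarrow> ('e \<Rightarrow> 'b::real_normed_vector) \<Rightarrow> bool" where
  "smooth_on S h \<longleftrightarrow> (\<forall>k. k_smooth_on k S h)"

section \<open>Smooth manifolds\<close>

text \<open>
  A chart is a pair of its domain and a coordinate map, whose values outside the domain are
  irrelevant. The manifold is the whole type \<open>'a\<close> (of class \<open>t2_space\<close> and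
  \<open>second_countable_topology\<close> in the intended use), modelled on the Euclidean space \<open>'e\<close>.
\<close>

type_synonym ('a, 'e) chart = "'a set \<times> ('a \<Rightarrow> 'e)"

abbreviation cdom :: "('a, 'e) chart \<Rightarrow> 'a set" where
  "cdom c \<equiv> fst c"

abbreviation coord :: "('a, 'e) chart \<Rightarrow> 'a \<Rightarrow> 'e" where
  "coord c \<equiv> snd c"

definition param :: "('a, 'e) chart \<Rightarrow> 'e \<Rightarrow> 'a" where
  "param c = inv_into (cdom c) (coord c)"

definition smooth_atlas ::
  "('a::topological_space, 'e::euclidean_space) chart set \<Rightarrow> bool" where
  "smooth_atlas A \<longleftrightarrow>
     (\<forall>c\<in>A. open (cdom c) \<and> open (coord c ` cdom c) \<and>
        homeomorphism (cdom c) (coord c ` cdom c) (coord c) (param c)) \<and>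
     (\<Union>c\<in>A. cdom c) = UNIV \<and>
     (\<forall>c\<in>A. \<forall>d\<in>A. smooth_on (coord c ` (cdom c \<inter> cdom d)) (coord d \<circ> param c))"

definition smooth_fun ::
  "('a, 'e::euclidean_space) chart set \<Rightarrow> 'a set \<Rightarrow> ('a \<Rightarrow> real) \<Rightarrow> bool" where
  "smooth_fun A U h \<longleftrightarrow> (\<forall>c\<in>A. smooth_on (coord c ` (cdom c \<inter> U)) (h \<circ> param c))"

section \<open>Tangent vectors and vector fields\<close>

text \<open>
  A tangent vector at \<open>p\<close> is the family of its coordinate vectors in all charts around \<open>p\<close>,
  transforming by the derivatives of the transition maps. Components at all other pairs are
  set to \<open>0\<close>, so that equality of tangent vectors is equality of functions. The vector space
  operations are componentwise.
\<close>

type_synonym ('a, 'e) tvec = "('a, 'e) chart \<Rightarrow> 'e"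

definition tangent_space ::
  "('a, 'e::euclidean_space) chart set \<Rightarrow> 'a \<Rightarrow> ('a, 'e) tvec set" where
  "tangent_space A p = {v.
     (\<forall>c. \<not> (c \<in> A \<and> p \<in> cdom c) \<longrightarrow> v c = 0) \<and>
     (\<forall>c\<in>A. \<forall>d\<in>A. p \<in> cdom c \<and> p \<in> cdom d \<longrightarrow>
        v d = frechet_derivative (coord d \<circ> param c) (at (coord c p)) (v c))}"

definition tzero :: "('a, 'e::real_vector) tvec" where
  "tzero = (\<lambda>c. 0)"

definition tadd :: "('a, 'e::real_vector) tvec \<Rightarrow> ('a, 'e) tvec \<Rightarrow> ('a, 'e) tvec"
    (infixl \<open>\<oplus>\<^sub>t\<close> 65) where
  "v \<oplus>\<^sub>t w = (\<lambda>c. v c + w c)"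

definition tscale :: "real \<Rightarrow> ('a, 'e::real_vector) tvec \<Rightarrow> ('a, 'e) tvec"
    (infixr \<open>\<odot>\<^sub>t\<close> 75) where
  "a \<odot>\<^sub>t v = (\<lambda>c. a *\<^sub>R v c)"

text \<open>
  The differential of a function at \<open>p\<close>, applied to a tangent vector \<open>v\<close> at \<open>p\<close>; by the
  transformation rule for \<open>v\<close>, the value does not depend on the chosen chart.
\<close>

definition chart_at :: "('a, 'e) chart set \<Rightarrow> 'a \<Rightarrow> ('a, 'e) chart" where
  "chart_at A p = (SOME c. c \<in> A \<and> p \<in> cdom c)"

definition differential ::
  "('a, 'e::euclidean_space) chart set \<Rightarrow> ('a \<Rightarrow> real) \<Rightarrow> 'a \<Rightarrow> ('a, 'e) tvec \<Rightarrow> real" where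
  "differential A h p v =
     (let c = chart_at A p in frechet_derivative (h \<circ> param c) (at (coord c p)) (v c))"

text \<open>Smooth vector fields on the open set \<open>U\<close>; values outside \<open>U\<close> are unconstrained.\<close>

definition vector_fields ::
  "('a, 'e::euclidean_space) chart set \<Rightarrow> 'a set \<Rightarrow> ('a \<Rightarrow> ('a, 'e) tvec) set" where
  "vector_fields A U = {X.
     (\<forall>p\<in>U. X p \<in> tangent_space A p) \<and>
     (\<forall>c\<in>A. smooth_on (coord c ` (cdom c \<inter> U)) (\<lambda>x. X (param c x) c))}"

section \<open>Riemannian metrics and gradients\<close>

type_synonym ('a, 'e) metric = "'a \<Rightarrow> ('a, 'e) tvec \<Rightarrow> ('a, 'e) tvec \<Rightarrow> real"

definition riemannian_metric ::
  "('a::topological_space, 'e::euclidean_space) chart set \<Rightarrow> ('a, 'e) metric \<Rightarrow> bool" where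
  "riemannian_metric A g \<longleftrightarrow>
     (\<forall>p. \<forall>u\<in>tangent_space A p. \<forall>v\<in>tangent_space A p.
        g p u v = g p v u \<and>
        (u \<noteq> tzero \<longrightarrow> 0 < g p u u) \<and>
        (\<forall>w\<in>tangent_space A p. \<forall>a b. g p (a \<odot>\<^sub>t u \<oplus>\<^sub>t b \<odot>\<^sub>t v) w = a * g p u w + b * g p v w)) \<and>
     (\<forall>U. open U \<longrightarrow> (\<forall>X\<in>vector_fields A U. \<forall>Y\<in>vector_fields A U.
        smooth_fun A U (\<lambda>p. g p (X p) (Y p))))"

definition tnorm :: "('a, 'e) metric \<Rightarrow> 'a \<Rightarrow> ('a, 'e) tvec \<Rightarrow> real" where
  "tnorm g p v = sqrt (g p v v)"

definition grad ::
  "('a, 'e::euclidean_space) chart set \<Rightarrow> ('a, 'e) metric \<Rightarrow> ('a \<Rightarrow> real) \<Rightarrow> 'a \<Rightarrow> ('a, 'e) tvec"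
  where
  "grad A g f p = (THE v. v \<in> tangent_space A p \<and>
     (\<forall>w\<in>tangent_space A p. g p v w = differential A f p w))"

definition critical_points ::
  "('a, 'e::euclidean_space) chart set \<Rightarrow> ('a \<Rightarrow> real) \<Rightarrow> 'a set" where
  "critical_points A f = {p. \<forall>v\<in>tangent_space A p. differential A f p v = 0}"

section \<open>Affine connections and non-metricity\<close>

text \<open>
  \<open>nabla W X\<close> is the covariant derivative of \<open>X\<close> along \<open>W\<close>. Only the values on \<open>U\<close> matter:
  the functions \<open>h\<close>, \<open>k\<close> below are arbitrary outside \<open>U\<close>, so (taking for example the
  indicator function of \<open>U\<close>) the axioms imply that \<open>nabla W X\<close> on \<open>U\<close> depends on the
  restrictions of \<open>W\<close> and \<open>X\<close> to \<open>U\<close> only.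
\<close>

type_synonym ('a, 'e) connection =
  "('a \<Rightarrow> ('a, 'e) tvec) \<Rightarrow> ('a \<Rightarrow> ('a, 'e) tvec) \<Rightarrow> 'a \<Rightarrow> ('a, 'e) tvec"

definition affine_connection ::
  "('a, 'e::euclidean_space) chart set \<Rightarrow> 'a set \<Rightarrow> ('a, 'e) connection \<Rightarrow> bool" where
  "affine_connection A U nabla \<longleftrightarrow>
     (\<forall>W\<in>vector_fields A U. \<forall>X\<in>vector_fields A U. nabla W X \<in> vector_fields A U) \<and>
     (\<forall>W\<in>vector_fields A U. \<forall>W'\<in>vector_fields A U. \<forall>X\<in>vector_fields A U.
        \<forall>h k. smooth_fun A U h \<longrightarrow> smooth_fun A U k \<longrightarrow>
          (\<forall>p\<in>U. nabla (\<lambda>r. h r \<odot>\<^sub>t W r \<oplus>\<^sub>t k r \<odot>\<^sub>t W' r) X p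
                  = h p \<odot>\<^sub>t nabla W X p \<oplus>\<^sub>t k p \<odot>\<^sub>t nabla W' X p)) \<and>
     (\<forall>W\<in>vector_fields A U. \<forall>X\<in>vector_fields A U. \<forall>Y\<in>vector_fields A U.
        \<forall>p\<in>U. nabla W (\<lambda>r. X r \<oplus>\<^sub>t Y r) p = nabla W X p \<oplus>\<^sub>t nabla W Y p) \<and>
     (\<forall>W\<in>vector_fields A U. \<forall>X\<in>vector_fields A U. \<forall>h. smooth_fun A U h \<longrightarrow>
        (\<forall>p\<in>U. nabla W (\<lambda>r. h r \<odot>\<^sub>t X r) p
                = differential A h p (W p) \<odot>\<^sub>t X p \<oplus>\<^sub>t h p \<odot>\<^sub>t nabla W X p))"

definition straightens ::
  "('a, 'e::euclidean_space) chart set \<Rightarrow> ('a, 'e) metric \<Rightarrow> ('a \<Rightarrow> real) \<Rightarrow> 'a set \<Rightarrow>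
     ('a, 'e) connection \<Rightarrow> ('a \<Rightarrow> real) \<Rightarrow> bool" where
  "straightens A g f U nabla lam \<longleftrightarrow>
     (\<forall>p\<in>U. nabla (grad A g f) (grad A g f) p = lam p \<odot>\<^sub>t grad A g f p)"

definition nonmetricity_field ::
  "('a, 'e::euclidean_space) chart set \<Rightarrow> ('a, 'e) metric \<Rightarrow> ('a, 'e) connection \<Rightarrow>
     ('a \<Rightarrow> ('a, 'e) tvec) \<Rightarrow> ('a \<Rightarrow> ('a, 'e) tvec) \<Rightarrow> ('a \<Rightarrow> ('a, 'e) tvec) \<Rightarrow> 'a \<Rightarrow> real" where
  "nonmetricity_field A g nabla W X Y p =
     differential A (\<lambda>r. g r (X r) (Y r)) p (W p)
       - g p (nabla W X p) (Y p) - g p (X p) (nabla W Y p)"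

text \<open>
  The expression above is \<open>C\<^sup>\<infinity>\<close>-linear in each of the three fields, hence a tensor: its value
  on tangent vectors \<open>w\<close>, \<open>x\<close>, \<open>y\<close> at a point \<open>p\<close> of \<open>U\<close> is the common value for all
  smooth vector fields on \<open>U\<close> that extend these vectors.
\<close>

definition nonmetricity ::
  "('a, 'e::euclidean_space) chart set \<Rightarrow> ('a, 'e) metric \<Rightarrow> 'a set \<Rightarrow> ('a, 'e) connection \<Rightarrow>
     'a \<Rightarrow> ('a, 'e) tvec \<Rightarrow> ('a, 'e) tvec \<Rightarrow> ('a, 'e) tvec \<Rightarrow> real" where
  "nonmetricity A g U nabla p w x y = (THE r.
     \<forall>W\<in>vector_fields A U. \<forall>X\<in>vector_fields A U. \<forall>Y\<in>vector_fields A U.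
       W p = w \<longrightarrow> X p = x \<longrightarrow> Y p = y \<longrightarrow> nonmetricity_field A g nabla W X Y p = r)"

section \<open>Curves\<close>

definition differentiable_curve ::
  "('a::topological_space, 'e::euclidean_space) chart set \<Rightarrow> real set \<Rightarrow> (real \<Rightarrow> 'a) \<Rightarrow> bool"
  where
  "differentiable_curve A I \<gamma> \<longleftrightarrow> continuous_on I \<gamma> \<and>
     (\<forall>t\<in>I. \<forall>c\<in>A. \<gamma> t \<in> cdom c \<longrightarrow> (coord c \<circ> \<gamma>) differentiable (at t within I))"

definition velocity ::
  "('a, 'e::euclidean_space) chart set \<Rightarrow> real set \<Rightarrow> (real \<Rightarrow> 'a) \<Rightarrow> real \<Rightarrow> ('a, 'e) tvec" where
  "velocity A I \<gamma> t = (\<lambda>c. if c \<in> A \<and> \<gamma> t \<in> cdom c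
     then vector_derivative (coord c \<circ> \<gamma>) (at t within I) else 0)"

definition gradient_descent_curve ::
  "('a::topological_space, 'e::euclidean_space) chart set \<Rightarrow> ('a, 'e) metric \<Rightarrow>
     ('a \<Rightarrow> real) \<Rightarrow> (real \<Rightarrow> 'a) \<Rightarrow> bool" where
  "gradient_descent_curve A g f \<gamma> \<longleftrightarrow> differentiable_curve A {0..} \<gamma> \<and>
     (\<forall>t\<ge>0. velocity A {0..} \<gamma> t = (- 1) \<odot>\<^sub>t grad A g f (\<gamma> t))"

end

(*
  Along a descent curve, f decreases at the rate E = g(grad f, grad f), and the straightening
  condition turns the derivative of E into C(v, v, v) - 2 lam E, where v is the velocity. Let D be
  the difference of the values of f along the two curves. If D were positive somewhere, it would
  have a positive maximum at some t > 0, because it vanishes at 0 and at infinity. There E takes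
  the same value on both curves, and the hypothesis on C makes the derivative of the difference of
  the two values of E negative, so that D is strictly increasing just after t: a contradiction.
  The curves are not critical at t, since a descent curve that meets a critical point rests there
  and is thus at q.
*)
theory Submission
  imports Defs
begin

section \<open>Calculus of smooth functions\<close>

text \<open>The term -2 lam E comes from nabla_v v = - lam v, which is the straightening condition
  for v = - grad f. Since lam is one constant for both curves, these terms cancel wherever the two
  values of E agree; and equal E means equal speed, so the hypothesis on C is available at exactly
  the times at which D has derivative 0. Critical points need care because the connection is only
  guaranteed away from them. If the first curve is at q, then f is minimal there and D cannot be
  positive; equality of E then excludes a critical point on the second curve as well. Most of the
  work gives meaning to the objects: \<open>grad\<close> and \<open>nonmetricity\<close> are
  definite descriptions. The gradient is obtained by solving positive definite linear systems that
  depend smoothly on the point. For the non-metricity it must be shown that its value at p depends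
  on the three fields only through their values at p; as the fields live on all of \<open>U\<close>
  while frames exist only in charts, this takes bump functions.\<close>

lemma k_smooth_on_SucD: "k_smooth_on (Suc k) S h \<Longrightarrow> k_smooth_on k S h"
proof (induction k arbitrary: h)
  case 0
  then show ?case
    by (auto intro!: continuous_at_imp_continuous_on differentiable_imp_continuous_within)
next
  case (Suc k)
  then show ?case by (metis k_smooth_on.simps(2))
qed

lemma k_smooth_on_subset: "k_smooth_on k S h \<Longrightarrow> T \<subseteq> S \<Longrightarrow> k_smooth_on k T h"
  by (induction k arbitrary: h) (auto intro: continuous_on_subset)

lemma differentiable_transform_open:
  assumes "h differentiable (at x)" "open S" "x \<in> S" "\<And>y. y \<in> S \<Longrightarrow> h y = h' y"
  shows "h' differentiable (at x)" "frechet_derivative h' (at x) = frechet_derivative h (at x)"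
proof -
  have "(h' has_derivative frechet_derivative h (at x)) (at x)"
    using has_derivative_transform_within_open[of h "frechet_derivative h (at x)" x UNIV S h'] assms
    by (simp add: frechet_derivative_works)
  then show "h' differentiable (at x)" "frechet_derivative h' (at x) = frechet_derivative h (at x)"
    by (auto simp: differentiable_def frechet_derivative_at[symmetric])
qed

text \<open>Two functions that agree on an open set have the same Frechet derivatives there, so the
  induction can pass from the functions to their directional derivatives.\<close>

lemma k_smooth_on_cong:
  assumes "open S" "\<And>x. x \<in> S \<Longrightarrow> h x = h' x" "k_smooth_on k S h"
  shows "k_smooth_on k S h'"
  using assms(2,3)
proof (induction k arbitrary: h h')
  case 0
  then show ?case using continuous_on_cong by force
next
  case (Suc k)
  have "k_smooth_on k S (\<lambda>x. frechet_derivative h' (at x) v)" for v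
    by (rule Suc.IH[where h="\<lambda>x. frechet_derivative h (at x) v"])
       (use Suc.prems assms(1) differentiable_transform_open(2)[of h _ S h'] in auto)
  then show ?case
    using Suc.prems assms(1) differentiable_transform_open(1)[of h _ S h'] by auto
qed

text \<open>\<open>frechet_derivative\<close> is a choice term. This rule lets the closure proofs
  below supply an explicit derivative \<open>h'\<close> and argue about its directional values
  instead.\<close>

lemma k_smooth_on_SucI:
  assumes "open S" "\<And>x. x \<in> S \<Longrightarrow> (h has_derivative h' x) (at x)"
    and "\<And>v. k_smooth_on k S (\<lambda>x. h' x v)"
  shows "k_smooth_on (Suc k) S h"
proof -
  have "k_smooth_on k S (\<lambda>x. frechet_derivative h (at x) v)" for v
    by (rule k_smooth_on_cong[OF assms(1) _ assms(3)[of v]])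
       (use assms(2) frechet_derivative_at in metis)
  then show ?thesis using assms(2) by (auto simp: differentiable_def)
qed

lemma k_smooth_on_has_derivative:
  assumes "k_smooth_on (Suc k) S h" "x \<in> S"
  shows "(h has_derivative frechet_derivative h (at x)) (at x)"
  using assms by (simp add: frechet_derivative_works)

lemma k_smooth_on_const: "open S \<Longrightarrow> k_smooth_on k S (\<lambda>x. c)"
  by (induction k arbitrary: c) (auto simp: frechet_derivative_const)

lemma k_smooth_on_bounded_linear:
  assumes "bounded_linear L" "open S" "k_smooth_on k S h"
  shows "k_smooth_on k S (\<lambda>x. L (h x))"
  using assms(3)
proof (induction k arbitrary: h)
  case 0
  then show ?case using assms(1) by (auto intro: bounded_linear.continuous_on)
next
  case (Suc k)
  show ?case
    by (rule k_smooth_on_SucI[OF assms(2) bounded_linear.has_derivative[OF assms(1)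
          k_smooth_on_has_derivative[OF Suc.prems]]])
       (use Suc in auto)
qed

lemma k_smooth_on_id: "open S \<Longrightarrow> k_smooth_on k S (\<lambda>x. x)"
  by (cases k) (auto intro!: k_smooth_on_SucI k_smooth_on_const has_derivative_ident)

lemma k_smooth_on_add:
  assumes "open S" "k_smooth_on k S h" "k_smooth_on k S h'"
  shows "k_smooth_on k S (\<lambda>x. h x + h' x)"
  using assms(2,3)
proof (induction k arbitrary: h h')
  case 0
  then show ?case by (auto intro: continuous_on_add)
next
  case (Suc k)
  show ?case
    by (rule k_smooth_on_SucI[OF assms(1) has_derivative_add[OF
          k_smooth_on_has_derivative[OF Suc.prems(1)] k_smooth_on_has_derivative[OF Suc.prems(2)]]])
       (use Suc in auto)
qed

lemma k_smooth_on_scaleR: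
  assumes "open S" "k_smooth_on k S a" "k_smooth_on k S h"
  shows "k_smooth_on k S (\<lambda>x. a x *\<^sub>R h x)"
  using assms(2,3)
proof (induction k arbitrary: a h)
  case 0
  then show ?case by (auto intro: continuous_on_scaleR)
next
  case (Suc k)
  \<comment> \<open>The product rule leaves \<open>a\<close> and \<open>h\<close> themselves next to
    a derivative, so smoothness of order \<open>k\<close> of both is needed along with that of their
    derivatives.\<close>
  note SucD = Suc.prems[THEN k_smooth_on_SucD]
  show ?case
    by (rule k_smooth_on_SucI[OF assms(1) has_derivative_scaleR[OF
          k_smooth_on_has_derivative[OF Suc.prems(1)] k_smooth_on_has_derivative[OF Suc.prems(2)]]])
       (use Suc SucD in \<open>auto intro!: k_smooth_on_add[OF assms(1)]\<close>)
qed

lemma k_smooth_on_sum: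
  assumes "open S" "\<And>i. i \<in> I \<Longrightarrow> k_smooth_on k S (h i)"
  shows "k_smooth_on k S (\<lambda>x. \<Sum>i\<in>I. h i x)"
  using assms(2)
  by (induction I rule: infinite_finite_induct)
     (auto intro!: k_smooth_on_const k_smooth_on_add assms(1))

text \<open>In the chain rule both the linear map and its argument vary with x. Expanding the inner
  derivative in the basis of \<open>'b\<close> leaves a finite sum of scalar functions times
  directional derivatives of \<open>h'\<close> along fixed vectors, taken at \<open>h x\<close>; the
  induction hypothesis, general in \<open>h'\<close>, applies to these.\<close>

lemma k_smooth_on_compose:
  fixes h :: "'a::euclidean_space \<Rightarrow> 'b::euclidean_space" and h' :: "'b \<Rightarrow> 'c::real_normed_vector"
  assumes "open S" "open T" "h ` S \<subseteq> T" "k_smooth_on k S h" "k_smooth_on k T h'"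
  shows "k_smooth_on k S (\<lambda>x. h' (h x))"
  using assms(4,5)
proof (induction k arbitrary: h')
  case 0
  then show ?case using assms(3) by (auto intro: continuous_on_compose2)
next
  case (Suc k)
  have eq: "(\<Sum>i\<in>Basis. (frechet_derivative h (at x) v \<bullet> i) *\<^sub>R frechet_derivative h' (at (h x)) i)
     = frechet_derivative h' (at (h x)) (frechet_derivative h (at x) v)" if "x \<in> S" for x v
  proof -
    have lin: "linear (frechet_derivative h' (at (h x)))"
      using Suc.prems(2) assms(3) that by (auto intro: linear_frechet_derivative)
    have "frechet_derivative h' (at (h x)) (\<Sum>i\<in>Basis. (frechet_derivative h (at x) v \<bullet> i) *\<^sub>R i)
      = (\<Sum>i\<in>Basis. (frechet_derivative h (at x) v \<bullet> i) *\<^sub>R frechet_derivative h' (at (h x)) i)"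
      by (simp only: linear_sum[OF lin] linear_scale[OF lin])
    then show ?thesis by (simp only: euclidean_representation)
  qed
  have "k_smooth_on k S (\<lambda>x. frechet_derivative h' (at (h x)) (frechet_derivative h (at x) v))" for v
  proof (rule k_smooth_on_cong[OF assms(1) eq])
    show "k_smooth_on k S (\<lambda>x. \<Sum>i\<in>Basis. (frechet_derivative h (at x) v \<bullet> i) *\<^sub>R
        frechet_derivative h' (at (h x)) i)"
    proof (intro k_smooth_on_sum k_smooth_on_scaleR assms(1))
      fix i :: 'b
      show "k_smooth_on k S (\<lambda>x. frechet_derivative h (at x) v \<bullet> i)"
        using Suc.prems(1)
        by (intro k_smooth_on_bounded_linear[OF bounded_linear_inner_left assms(1)]) auto
      show "k_smooth_on k S (\<lambda>x. frechet_derivative h' (at (h x)) i)"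
        using Suc.prems(2) by (intro Suc.IH[OF Suc.prems(1)[THEN k_smooth_on_SucD],
            of "\<lambda>y. frechet_derivative h' (at y) i"]) auto
    qed
  qed
  then show ?case
    by (rule k_smooth_on_SucI[OF assms(1), rotated])
       (rule has_derivative_compose[OF k_smooth_on_has_derivative[OF Suc.prems(1)]
            k_smooth_on_has_derivative[OF Suc.prems(2)]], use assms(3) in auto)
qed

text \<open>The derivative of 1/h is -(1/h) Dh (1/h), so 1/h is of order \<open>k + 1\<close> as
  soon as 1/h itself is of order \<open>k\<close>.\<close>

lemma k_smooth_on_inverse:
  fixes h :: "'a::euclidean_space \<Rightarrow> real"
  assumes "open S" "\<And>x. x \<in> S \<Longrightarrow> h x \<noteq> 0" "k_smooth_on k S h"
  shows "k_smooth_on k S (\<lambda>x. inverse (h x))"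
  using assms(3)
proof (induction k)
  case 0
  then show ?case using assms(2) by (auto intro: continuous_on_inverse)
next
  case (Suc k)
  then have *: "k_smooth_on k S (\<lambda>x. inverse (h x))" using k_smooth_on_SucD by blast
  have "k_smooth_on k S (\<lambda>x. (-1) *\<^sub>R (inverse (h x) *\<^sub>R (frechet_derivative h (at x) v *\<^sub>R inverse (h x))))" for v
    using Suc.prems * by (intro k_smooth_on_scaleR k_smooth_on_const assms(1)) auto
  then show ?case
    by (intro k_smooth_on_SucI[OF assms(1) Deriv.has_derivative_inverse[OF assms(2)
          k_smooth_on_has_derivative[OF Suc.prems]]]) (auto simp: mult_ac)
qed

lemma k_smooth_on_Un:
  "open S \<Longrightarrow> open T \<Longrightarrow> k_smooth_on k S h \<Longrightarrow> k_smooth_on k T h \<Longrightarrow> k_smooth_on k (S \<union> T) h"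
  by (induction k arbitrary: h) (auto intro: continuous_on_open_Un)

lemma smooth_on_subset: "smooth_on S h \<Longrightarrow> T \<subseteq> S \<Longrightarrow> smooth_on T h"
  by (auto simp: smooth_on_def intro: k_smooth_on_subset)

lemma smooth_on_cong:
  "open S \<Longrightarrow> (\<And>x. x \<in> S \<Longrightarrow> h x = h' x) \<Longrightarrow> smooth_on S h \<Longrightarrow> smooth_on S h'"
  unfolding smooth_on_def using k_smooth_on_cong by blast

lemma smooth_on_const: "open S \<Longrightarrow> smooth_on S (\<lambda>x. c)"
  by (simp add: smooth_on_def k_smooth_on_const)

lemma smooth_on_id: "open S \<Longrightarrow> smooth_on S (\<lambda>x. x)"
  by (simp add: smooth_on_def k_smooth_on_id)

lemma smooth_on_bounded_linear:
  "bounded_linear L \<Longrightarrow> open S \<Longrightarrow> smooth_on S h \<Longrightarrow> smooth_on S (\<lambda>x. L (h x))"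
  by (simp add: smooth_on_def k_smooth_on_bounded_linear)

lemma smooth_on_add:
  "open S \<Longrightarrow> smooth_on S h \<Longrightarrow> smooth_on S h' \<Longrightarrow> smooth_on S (\<lambda>x. h x + h' x)"
  by (simp add: smooth_on_def k_smooth_on_add)

lemma smooth_on_scaleR:
  "open S \<Longrightarrow> smooth_on S a \<Longrightarrow> smooth_on S h \<Longrightarrow> smooth_on S (\<lambda>x. a x *\<^sub>R h x)"
  by (simp add: smooth_on_def k_smooth_on_scaleR)

lemma smooth_on_mult:
  fixes a h :: "'a::euclidean_space \<Rightarrow> real"
  shows "open S \<Longrightarrow> smooth_on S a \<Longrightarrow> smooth_on S h \<Longrightarrow> smooth_on S (\<lambda>x. a x * h x)"
  using smooth_on_scaleR[of S a h] by simp

lemma smooth_on_diff: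
  assumes "open S" "smooth_on S h" "smooth_on S h'"
  shows "smooth_on S (\<lambda>x. h x - h' x)"
  using smooth_on_add[OF assms(1,2) smooth_on_scaleR[OF assms(1) smooth_on_const[OF assms(1), of "-1"]
        assms(3)]] by simp

lemma smooth_on_sum:
  "open S \<Longrightarrow> (\<And>i. i \<in> I \<Longrightarrow> smooth_on S (h i)) \<Longrightarrow> smooth_on S (\<lambda>x. \<Sum>i\<in>I. h i x)"
  by (simp add: smooth_on_def k_smooth_on_sum)

lemma smooth_on_compose:
  fixes h :: "'a::euclidean_space \<Rightarrow> 'b::euclidean_space"
  shows "open S \<Longrightarrow> open T \<Longrightarrow> h ` S \<subseteq> T \<Longrightarrow> smooth_on S h \<Longrightarrow> smooth_on T h'
    \<Longrightarrow> smooth_on S (\<lambda>x. h' (h x))"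
  by (auto simp: smooth_on_def intro: k_smooth_on_compose)

lemma smooth_on_inverse:
  fixes h :: "'a::euclidean_space \<Rightarrow> real"
  shows "open S \<Longrightarrow> (\<And>x. x \<in> S \<Longrightarrow> h x \<noteq> 0) \<Longrightarrow> smooth_on S h \<Longrightarrow> smooth_on S (\<lambda>x. inverse (h x))"
  by (simp add: smooth_on_def k_smooth_on_inverse)

lemma smooth_on_Un:
  "open S \<Longrightarrow> open T \<Longrightarrow> smooth_on S h \<Longrightarrow> smooth_on T h \<Longrightarrow> smooth_on (S \<union> T) h"
  by (simp add: smooth_on_def k_smooth_on_Un)

lemma smooth_on_differentiable: "smooth_on S h \<Longrightarrow> x \<in> S \<Longrightarrow> h differentiable (at x)"
  unfolding smooth_on_def by (metis k_smooth_on.simps(2))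

lemma smooth_on_frechet_derivative:
  "smooth_on S h \<Longrightarrow> smooth_on S (\<lambda>x. frechet_derivative h (at x) v)"
  unfolding smooth_on_def by (metis k_smooth_on.simps(2))

text \<open>For s > 0 the functions s^(-n) exp(-1/s) are closed under differentiation up to linear
  combinations, which is why the power is carried along. At 0 everything rests on exp(-1/s) decaying
  faster than any power of s.\<close>

lemma has_real_derivative_exp_inverse_power:
  fixes s :: real
  defines "h \<equiv> \<lambda>(n::nat) s. if s > 0 then inverse s ^ n * exp (- inverse s) else (0::real)"
  shows "(h n has_real_derivative (- real n * h (Suc n) s + h (Suc (Suc n)) s)) (at s)"
proof -
  consider "s > 0" | "s < 0" | "s = 0" by linarith
  then show ?thesis
  proof cases
    case 1
    have "((\<lambda>s. inverse s ^ n * exp (- inverse s)) has_real_derivative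
       (- real n * h (Suc n) s + h (Suc (Suc n)) s)) (at s)"
      using 1 unfolding h_def
      by (cases n) (auto intro!: derivative_eq_intros simp: field_simps power2_eq_square,
          metis One_nat_def power_eq_if)
    then show ?thesis
      by (rule DERIV_cong_ev[THEN iffD1, rotated -1, OF _])
         (use 1 eventually_nhds_in_open[of "{0<..}" s] in \<open>auto simp: h_def elim!: eventually_mono\<close>)
  next
    case 2
    have "((\<lambda>s. 0) has_real_derivative (- real n * h (Suc n) s + h (Suc (Suc n)) s)) (at s)"
      using 2 by (auto simp: h_def)
    then show ?thesis
      by (rule DERIV_cong_ev[THEN iffD1, rotated -1, OF _])
         (use 2 eventually_nhds_in_open[of "{..<0}" s] in \<open>auto simp: h_def elim!: eventually_mono\<close>)
  next
    case 3
    have lim: "((\<lambda>s. h m s) \<longlongrightarrow> 0) (at 0)" for m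
    proof (rule filterlim_split_at)
      show "((\<lambda>s. h m s) \<longlongrightarrow> 0) (at_left 0)"
        by (rule tendsto_eventually) (auto simp: h_def eventually_at_filter)
      have "((\<lambda>s. inverse s ^ m / exp (inverse s)) \<longlongrightarrow> 0) (at_right (0::real))"
        by (rule filterlim_compose[OF tendsto_power_div_exp_0 filterlim_inverse_at_top_right])
      then show "((\<lambda>s. h m s) \<longlongrightarrow> 0) (at_right 0)"
        by (rule Lim_transform_eventually)
           (auto simp: h_def eventually_at_filter exp_minus field_simps)
    qed
    \<comment> \<open>Dividing by y raises the power by one, so the difference quotient at 0 is
      again a member of the family. The case y = 0 holds because division by zero yields 0.\<close>
    have "(h n y - h n 0) / (y - 0) = h (Suc n) y" for y
      by (auto simp: h_def field_simps)
    then show ?thesis using lim[of "Suc n"] 3 by (simp add: has_field_derivative_iff h_def)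
  qed
qed

text \<open>Differentiating \<open>h n\<close> leads to higher indices, so the order of smoothness
  is raised for all \<open>n\<close> at once and specialised to n = 0 only at the end.\<close>

lemma smooth_on_exp_inverse: "smooth_on UNIV (\<lambda>s::real. if s > 0 then exp (- inverse s) else 0)"
proof -
  define h where "h = (\<lambda>(n::nat) s. if s > 0 then inverse s ^ n * exp (- inverse s) else (0::real))"
  have D: "(h n has_real_derivative (- real n * h (Suc n) s + h (Suc (Suc n)) s)) (at s)" for n s
    unfolding h_def by (rule has_real_derivative_exp_inverse_power)
  have "k_smooth_on k UNIV (h n)" for k n
  proof (induction k arbitrary: n)
    case 0
    show ?case
      using DERIV_isCont[OF D] by (auto intro: continuous_at_imp_continuous_on)
  next
    case (Suc k)
    have "k_smooth_on k UNIV (\<lambda>s. v *\<^sub>R ((- real n) *\<^sub>R h (Suc n) s + h (Suc (Suc n)) s))" for v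
      by (intro k_smooth_on_scaleR k_smooth_on_add k_smooth_on_const Suc) auto
    then show ?case
      using D[of n]
      by (intro k_smooth_on_SucI[where h'="\<lambda>s. (*) (- real n * h (Suc n) s + h (Suc (Suc n)) s)"])
         (auto simp: has_field_derivative_def mult.commute)
  qed
  then have "smooth_on UNIV (h 0)" by (simp add: smooth_on_def)
  then show ?thesis by (simp add: h_def cong: if_cong)
qed

text \<open>With phi(s) = exp(-1/s) for s > 0 and 0 otherwise, the bump is phi(r^2 - |x - x0|^2) /
  phi(r^2). The squared distance is written as a sum over the basis, which makes it a polynomial in
  the coordinates.\<close>

lemma smooth_bump:
  fixes x0 :: "'e::euclidean_space"
  assumes "r > 0"
  obtains \<psi> :: "'e \<Rightarrow> real" where "smooth_on UNIV \<psi>" "\<psi> x0 = 1" "\<And>x. x \<notin> cball x0 r \<Longrightarrow> \<psi> x = 0"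
proof -
  define \<phi> where "\<phi> = (\<lambda>s::real. if s > 0 then exp (- inverse s) else 0)"
  define u where "u = (\<lambda>x. r\<^sup>2 - (\<Sum>i\<in>Basis. ((x - x0) \<bullet> i) * ((x - x0) \<bullet> i)))"
  have u: "u x = r\<^sup>2 - (dist x x0)\<^sup>2" for x
    using euclidean_inner[of "x - x0" "x - x0"] by (simp add: u_def dist_norm power2_norm_eq_inner)
  have 1: "smooth_on UNIV (\<lambda>x. (x - x0) \<bullet> i)" for i
    by (rule smooth_on_bounded_linear[OF bounded_linear_inner_left])
       (rule open_UNIV smooth_on_diff smooth_on_id smooth_on_const)+
  have "smooth_on UNIV u"
    unfolding u_def
    by (rule smooth_on_diff smooth_on_const smooth_on_sum smooth_on_mult open_UNIV 1)+
  moreover have "smooth_on UNIV \<phi>" unfolding \<phi>_def by (rule smooth_on_exp_inverse)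
  ultimately have "smooth_on UNIV (\<lambda>x. \<phi> (u x))"
    using smooth_on_compose[of UNIV UNIV u \<phi>] by simp
  then have "smooth_on UNIV (\<lambda>x. inverse (\<phi> (r\<^sup>2)) * \<phi> (u x))"
    by (rule smooth_on_mult[OF open_UNIV smooth_on_const[OF open_UNIV]])
  moreover have "\<phi> (u x) = 0" if "x \<notin> cball x0 r" for x
  proof -
    have "u x \<le> 0"
      using that assms power_mono[of r "dist x x0" 2] by (simp add: u dist_commute)
    then show ?thesis by (simp add: \<phi>_def)
  qed
  moreover have "inverse (\<phi> (r\<^sup>2)) * \<phi> (u x0) = 1"
    using assms by (simp add: u \<phi>_def)
  ultimately show thesis
    by (intro that[of "\<lambda>x. inverse (\<phi> (r\<^sup>2)) * \<phi> (u x)"]) simp_all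
qed

section \<open>Positive definite linear systems with smooth coefficients\<close>

text \<open>Induction on the dimension: \<open>e - P\<close> is the orthogonal complement of the new basis
  vector \<open>e\<close>, and contributes \<open>b(e - P) / a(e - P, e - P)\<close> times itself to the solution.\<close>

lemma smooth_solution_posdef_span:
  fixes a :: "'e::euclidean_space \<Rightarrow> 'v::euclidean_space \<Rightarrow> 'v \<Rightarrow> real"
  assumes "finite B" "independent B" "open S"
    and lin: "\<And>x w. x \<in> S \<Longrightarrow> linear (\<lambda>u. a x u w)"
    and sym: "\<And>x u w. x \<in> S \<Longrightarrow> a x u w = a x w u"
    and pos: "\<And>x u. x \<in> S \<Longrightarrow> u \<noteq> 0 \<Longrightarrow> a x u u > 0"
    and a: "\<And>u w. smooth_on S (\<lambda>x. a x u w)"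
    and "\<And>x. x \<in> S \<Longrightarrow> linear (b x)"
    and "\<And>w. smooth_on S (\<lambda>x. b x w)"
  shows "\<exists>G. smooth_on S G \<and> (\<forall>x\<in>S. G x \<in> span B \<and> (\<forall>w\<in>span B. a x (G x) w = b x w))"
  using assms(1,2,8,9)
proof (induction B arbitrary: b rule: finite_induct)
  case empty
  have "b x 0 = 0 \<and> a x 0 0 = 0" if "x \<in> S" for x
    using that empty(2) lin linear_0 by blast
  then show ?case using smooth_on_const[OF \<open>open S\<close>, of 0] by (intro exI[of _ "\<lambda>_. 0"]) auto
next
  case (insert e B)
  have lin2: "linear (\<lambda>w. a x u w)" if "x \<in> S" for x u
    using lin[OF that, of u] sym[OF that] by simp
  have e: "e \<notin> span B" and ind: "independent B"
    using insert.prems(1) insert.hyps(2) by (auto simp: independent_insert)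
  \<comment> \<open>The right-hand side is \<open>a x e\<close>, so \<open>P x\<close> is the
    projection of \<open>e\<close> to \<open>span B\<close> that is orthogonal with respect to
    \<open>a x\<close>.\<close>
  obtain P where P: "smooth_on S P" "\<And>x. x \<in> S \<Longrightarrow> P x \<in> span B"
      "\<And>x w. x \<in> S \<Longrightarrow> w \<in> span B \<Longrightarrow> a x (P x) w = a x e w"
    using insert.IH[OF ind, of "\<lambda>x w. a x e w"] lin2 a by auto
  obtain G where G: "smooth_on S G" "\<And>x. x \<in> S \<Longrightarrow> G x \<in> span B"
      "\<And>x w. x \<in> S \<Longrightarrow> w \<in> span B \<Longrightarrow> a x (G x) w = b x w"
    using insert.IH[OF ind, of b] insert.prems by auto
  define n where "n x = e - P x" for x
  have n0: "n x \<noteq> 0" if "x \<in> S" for x using P(2)[OF that] e by (auto simp: n_def)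
  have n: "smooth_on S n"
    unfolding n_def by (intro smooth_on_diff smooth_on_const P(1) \<open>open S\<close>)
  \<comment> \<open>A functional that depends smoothly on x is evaluated at the moving vector
    \<open>n x\<close>; expanding \<open>n x\<close> over the standard basis leaves only fixed
    arguments.\<close>
  have comp: "smooth_on S (\<lambda>x. l x (n x))"
    if "\<And>x. x \<in> S \<Longrightarrow> linear (l x)" "\<And>w. smooth_on S (\<lambda>x. l x w)" for l :: "'e \<Rightarrow> 'v \<Rightarrow> real"
  proof (rule smooth_on_cong[OF \<open>open S\<close>])
    show "smooth_on S (\<lambda>x. \<Sum>i\<in>Basis. (n x \<bullet> i) * l x i)"
      by (intro smooth_on_sum smooth_on_mult that(2) \<open>open S\<close> n
          smooth_on_bounded_linear[OF bounded_linear_inner_left])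
    show "(\<Sum>i\<in>Basis. (n x \<bullet> i) * l x i) = l x (n x)" if "x \<in> S" for x
    proof -
      have "l x (\<Sum>i\<in>Basis. (n x \<bullet> i) *\<^sub>R i) = (\<Sum>i\<in>Basis. (n x \<bullet> i) * l x i)"
        using \<open>\<And>x. x \<in> S \<Longrightarrow> linear (l x)\<close>[OF that] by (simp add: linear_sum linear_scale)
      then show ?thesis by (simp add: euclidean_representation)
    qed
  qed
  have bn: "smooth_on S (\<lambda>x. b x (n x))" using insert.prems by (intro comp[of b])
  have an: "smooth_on S (\<lambda>x. a x u (n x))" for u
    using lin2 a by (intro comp[of "\<lambda>x. a x u"])
  \<comment> \<open>Both arguments move here: the second is covered by \<open>an\<close>, the first
    by one more expansion over the basis.\<close>
  have ann: "smooth_on S (\<lambda>x. a x (n x) (n x))"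
  proof (rule smooth_on_cong[OF \<open>open S\<close>])
    show "smooth_on S (\<lambda>x. \<Sum>i\<in>Basis. (n x \<bullet> i) * a x i (n x))"
      by (intro smooth_on_sum smooth_on_mult an \<open>open S\<close> n
          smooth_on_bounded_linear[OF bounded_linear_inner_left])
    show "(\<Sum>i\<in>Basis. (n x \<bullet> i) * a x i (n x)) = a x (n x) (n x)" if "x \<in> S" for x
    proof -
      have "a x (\<Sum>i\<in>Basis. (n x \<bullet> i) *\<^sub>R i) (n x) = (\<Sum>i\<in>Basis. (n x \<bullet> i) * a x i (n x))"
        by (simp only: linear_sum[OF lin[OF that, of "n x"]] linear_scale[OF lin[OF that, of "n x"]]
            real_scaleR_def)
      then show ?thesis by (simp only: euclidean_representation)
    qed
  qed
  have nn: "a x (n x) (n x) \<noteq> 0" if "x \<in> S" for x using pos[OF that n0[OF that]] by simp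
  define H where "H = (\<lambda>x. G x + (b x (n x) * inverse (a x (n x) (n x))) *\<^sub>R n x)"
  have "smooth_on S H"
    unfolding H_def
    by (intro smooth_on_add smooth_on_scaleR smooth_on_mult smooth_on_inverse G(1) bn ann n nn \<open>open S\<close>)
  moreover have "H x \<in> span (insert e B)" if "x \<in> S" for x
  proof -
    have "span B \<subseteq> span (insert e B)" by (intro span_mono) auto
    then show ?thesis
      using P(2)[OF that] G(2)[OF that] unfolding H_def n_def
      by (intro span_add span_scale span_diff span_base[of e]) auto
  qed
  moreover have "a x (H x) w = b x w" if x: "x \<in> S" and w: "w \<in> span (insert e B)" for x w
  proof -
    \<comment> \<open>Replacing \<open>e\<close> by \<open>n x\<close> costs a multiple of
      \<open>P x\<close>, which stays in \<open>span B\<close>. Hence every test vector is a vector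
      of \<open>span B\<close> plus a multiple of \<open>n x\<close>.\<close>
    obtain k where k: "w - k *\<^sub>R e \<in> span B" using w span_breakdown_eq[of w e B] by blast
    define w' where "w' = w - k *\<^sub>R e + k *\<^sub>R P x"
    have w': "w' \<in> span B" unfolding w'_def by (intro span_add span_scale P(2) x k)
    have w_eq: "w = w' + k *\<^sub>R n x" by (simp add: w'_def n_def algebra_simps)
    have orth: "a x (n x) u = 0" if "u \<in> span B" for u
      using P(3)[OF x that] linear_diff[OF lin[OF x, of u], of e "P x"] by (simp add: n_def)
    have H: "a x (H x) u = a x (G x) u + b x (n x) * inverse (a x (n x) (n x)) * a x (n x) u" for u
      using linear_add[OF lin[OF x, of u]] linear_scale[OF lin[OF x, of u]] by (simp add: H_def)
    have "a x (H x) w' = b x w'" using H[of w'] orth[OF w'] G(3)[OF x w'] by simp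
    moreover have "a x (H x) (n x) = b x (n x)"
      using H[of "n x"] orth[OF G(2)[OF x]] sym[OF x, of "G x" "n x"] nn[OF x] by simp
    ultimately show ?thesis
      using linear_add[OF lin2[OF x]] linear_scale[OF lin2[OF x]]
        linear_add[OF insert.prems(2)[OF x]] linear_scale[OF insert.prems(2)[OF x]]
      by (simp add: w_eq)
  qed
  ultimately show ?case by (intro exI[of _ H] conjI ballI)
qed

section \<open>Tangent vectors and gradients\<close>

lemma tadd_apply [simp]: "(v \<oplus>\<^sub>t w) c = v c + w c"
  by (simp add: tadd_def)

lemma tscale_apply [simp]: "(a \<odot>\<^sub>t v) c = a *\<^sub>R v c"
  by (simp add: tscale_def)

lemma tzero_apply [simp]: "tzero c = 0"
  by (simp add: tzero_def)

section \<open>Charts, coordinate fields and differentials\<close>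

locale manifold_atlas =
  fixes A :: "('a::t2_space, 'e::euclidean_space) chart set"
  assumes atlas: "smooth_atlas A"
begin

lemma open_cdom: "c \<in> A \<Longrightarrow> open (cdom c)"
  using atlas by (simp add: smooth_atlas_def)

lemma chart_homeomorphism:
  "c \<in> A \<Longrightarrow> homeomorphism (cdom c) (coord c ` cdom c) (coord c) (param c)"
  using atlas by (simp add: smooth_atlas_def)

lemma param_coord [simp]: "c \<in> A \<Longrightarrow> p \<in> cdom c \<Longrightarrow> param c (coord c p) = p"
  using chart_homeomorphism[of c] by (simp add: homeomorphism_def)

lemma open_coord_image:
  assumes "c \<in> A" "open V"
  shows "open (coord c ` (cdom c \<inter> V))"
proof -
  have "openin (top_of_set (coord c ` cdom c)) (coord c ` (cdom c \<inter> V))"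
    using homeomorphism_imp_open_map[OF chart_homeomorphism[OF assms(1)], of "cdom c \<inter> V"] assms(2)
    by (simp add: openin_open_Int)
  moreover have "open (coord c ` cdom c)"
    using atlas assms(1) by (simp add: smooth_atlas_def)
  ultimately show ?thesis using openin_open_eq by blast
qed

lemma open_coord_cdom: "c \<in> A \<Longrightarrow> open (coord c ` cdom c)"
  using open_coord_image[of c UNIV] by simp

lemma smooth_transition:
  "c \<in> A \<Longrightarrow> d \<in> A \<Longrightarrow> smooth_on (coord c ` (cdom c \<inter> cdom d)) (coord d \<circ> param c)"
  using atlas by (simp add: smooth_atlas_def)

lemma chart_at: "chart_at A p \<in> A" "p \<in> cdom (chart_at A p)"
proof -
  have "p \<in> (\<Union>c\<in>A. cdom c)" using atlas by (simp add: smooth_atlas_def)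
  then have "\<exists>c. c \<in> A \<and> p \<in> cdom c" by blast
  from someI_ex[OF this] show "chart_at A p \<in> A" "p \<in> cdom (chart_at A p)"
    by (auto simp: chart_at_def)
qed

lemma transition_has_derivative:
  assumes "c \<in> A" "d \<in> A" "p \<in> cdom c" "p \<in> cdom d"
  shows "(coord d \<circ> param c has_derivative frechet_derivative (coord d \<circ> param c) (at (coord c p)))
    (at (coord c p))"
  using smooth_on_differentiable[OF smooth_transition[OF assms(1,2)]] assms
  by (simp add: frechet_derivative_works)

lemma linear_transition:
  assumes "c \<in> A" "d \<in> A" "p \<in> cdom c" "p \<in> cdom d"
  shows "linear (frechet_derivative (coord d \<circ> param c) (at (coord c p)))"
  using has_derivative_linear[OF transition_has_derivative[OF assms]] .

text \<open>On the overlap of the two chart domains \<open>h \<circ> param c\<close> is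
  \<open>h \<circ> param d\<close> after the transition map, so this is the chain rule. The identity
  is only available on the image of the overlap, whose openness allows the transfer.\<close>

lemma chart_change_has_derivative:
  fixes h :: "'a \<Rightarrow> 'b::real_normed_vector"
  assumes "c \<in> A" "d \<in> A" "p \<in> cdom c" "p \<in> cdom d"
    and "(h \<circ> param d) differentiable (at (coord d p))"
  shows "((h \<circ> param c) has_derivative (\<lambda>v. frechet_derivative (h \<circ> param d) (at (coord d p))
      (frechet_derivative (coord d \<circ> param c) (at (coord c p)) v))) (at (coord c p))"
proof -
  have "(h \<circ> param d has_derivative frechet_derivative (h \<circ> param d) (at (coord d p)))
      (at ((coord d \<circ> param c) (coord c p)))"
    using assms by (simp add: frechet_derivative_works)
  from has_derivative_compose[OF transition_has_derivative[OF assms(1-4)] this]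
  show ?thesis
    by (rule has_derivative_transform_within_open[where s="coord c ` (cdom c \<inter> cdom d)"])
       (use assms open_coord_image open_cdom in auto)
qed

lemma frechet_derivative_chart_change:
  fixes h :: "'a \<Rightarrow> 'b::real_normed_vector"
  assumes "c \<in> A" "d \<in> A" "p \<in> cdom c" "p \<in> cdom d"
    and "(h \<circ> param d) differentiable (at (coord d p))"
  shows "frechet_derivative (h \<circ> param c) (at (coord c p)) v
    = frechet_derivative (h \<circ> param d) (at (coord d p))
       (frechet_derivative (coord d \<circ> param c) (at (coord c p)) v)"
  using fun_cong[OF frechet_derivative_at[OF chart_change_has_derivative[OF assms]], of v] by simp

text \<open>The field with constant components \<open>v\<close> in the chart \<open>c\<close>, given
  through its components in all charts. At a fixed point of the domain it inverts the map that reads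
  off the component at \<open>c\<close>, and thus identifies \<open>'e\<close> with the tangent
  space.\<close>

definition coord_field :: "('a, 'e) chart \<Rightarrow> 'e \<Rightarrow> 'a \<Rightarrow> ('a, 'e) tvec" where
  "coord_field c v p = (\<lambda>d. if d \<in> A \<and> p \<in> cdom d
     then frechet_derivative (coord d \<circ> param c) (at (coord c p)) v else 0)"

lemma coord_field_self [simp]:
  assumes "c \<in> A" "p \<in> cdom c"
  shows "coord_field c v p c = v"
proof -
  have "((\<lambda>x. x) has_derivative (\<lambda>v. v)) (at (coord c p))" by (rule has_derivative_ident)
  then have "(coord c \<circ> param c has_derivative (\<lambda>v. v)) (at (coord c p))"
    by (rule has_derivative_transform_within_open[where s="coord c ` cdom c"])
       (use assms open_coord_cdom in auto)
  from frechet_derivative_at[OF this, symmetric] show ?thesis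
    using assms by (simp add: coord_field_def)
qed

lemma tangent_spaceI:
  assumes "\<And>c. \<not> (c \<in> A \<and> p \<in> cdom c) \<Longrightarrow> v c = 0"
    and "\<And>c d. c \<in> A \<Longrightarrow> d \<in> A \<Longrightarrow> p \<in> cdom c \<Longrightarrow> p \<in> cdom d \<Longrightarrow>
      v d = frechet_derivative (coord d \<circ> param c) (at (coord c p)) (v c)"
  shows "v \<in> tangent_space A p"
  unfolding tangent_space_def mem_Collect_eq
proof (intro conjI allI ballI impI)
  fix c d assume "c \<in> A" "d \<in> A" "p \<in> cdom c \<and> p \<in> cdom d"
  then show "v d = frechet_derivative (coord d \<circ> param c) (at (coord c p)) (v c)"
    by (intro assms(2)) (elim conjE, assumption)+
qed (rule assms(1))

lemma tangent_spaceD: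
  assumes "v \<in> tangent_space A p"
  shows "\<not> (c \<in> A \<and> p \<in> cdom c) \<Longrightarrow> v c = 0"
    and "c \<in> A \<Longrightarrow> d \<in> A \<Longrightarrow> p \<in> cdom c \<Longrightarrow> p \<in> cdom d \<Longrightarrow>
      v d = frechet_derivative (coord d \<circ> param c) (at (coord c p)) (v c)"
  using assms[unfolded tangent_space_def mem_Collect_eq, THEN conjunct1, rule_format, of c]
    assms[unfolded tangent_space_def mem_Collect_eq, THEN conjunct2, rule_format, of c d]
  by blast+

lemma coord_field_tangent:
  assumes "c \<in> A" "p \<in> cdom c"
  shows "coord_field c v p \<in> tangent_space A p"
proof (rule tangent_spaceI)
  fix d e assume de: "d \<in> A" "e \<in> A" "p \<in> cdom d" "p \<in> cdom e"
  then show "coord_field c v p e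
      = frechet_derivative (coord e \<circ> param d) (at (coord d p)) (coord_field c v p d)"
    using frechet_derivative_chart_change[OF assms(1) de(1) assms(2) de(3)
        differentiableI[OF transition_has_derivative[OF de]]]
    by (simp add: coord_field_def)
qed (simp only: coord_field_def if_False)

lemma coord_field_eq:
  assumes "c \<in> A" "p \<in> cdom c" "u \<in> tangent_space A p"
  shows "coord_field c (u c) p = u"
proof
  fix d show "coord_field c (u c) p d = u d"
  proof (cases "d \<in> A \<and> p \<in> cdom d")
    case True
    then show ?thesis
      using tangent_spaceD(2)[OF assms(3,1) _ assms(2), of d] unfolding coord_field_def by presburger
  next
    case False
    then show ?thesis
      using tangent_spaceD(1)[OF assms(3) False] unfolding coord_field_def by presburger
  qed
qed

lemma tangent_vec_eqI:
  assumes "c \<in> A" "p \<in> cdom c" "u \<in> tangent_space A p" "v \<in> tangent_space A p" "u c = v c"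
  shows "u = v"
  using coord_field_eq[OF assms(1,2,3)] coord_field_eq[OF assms(1,2,4)] assms(5) by metis

lemma tadd_tangent:
  assumes "u \<in> tangent_space A p" "v \<in> tangent_space A p"
  shows "u \<oplus>\<^sub>t v \<in> tangent_space A p"
proof (rule tangent_spaceI)
  fix c d assume cd: "c \<in> A" "d \<in> A" "p \<in> cdom c" "p \<in> cdom d"
  show "(u \<oplus>\<^sub>t v) d = frechet_derivative (coord d \<circ> param c) (at (coord c p)) ((u \<oplus>\<^sub>t v) c)"
    unfolding tadd_apply linear_add[OF linear_transition[OF cd]]
      tangent_spaceD(2)[OF assms(1) cd] tangent_spaceD(2)[OF assms(2) cd] ..
next
  fix c assume n: "\<not> (c \<in> A \<and> p \<in> cdom c)"
  show "(u \<oplus>\<^sub>t v) c = 0"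
    using tangent_spaceD(1)[OF assms(1) n] tangent_spaceD(1)[OF assms(2) n] by simp
qed

lemma tscale_tangent:
  assumes "u \<in> tangent_space A p"
  shows "a \<odot>\<^sub>t u \<in> tangent_space A p"
proof (rule tangent_spaceI)
  fix c d assume cd: "c \<in> A" "d \<in> A" "p \<in> cdom c" "p \<in> cdom d"
  show "(a \<odot>\<^sub>t u) d = frechet_derivative (coord d \<circ> param c) (at (coord c p)) ((a \<odot>\<^sub>t u) c)"
    unfolding tscale_apply linear_scale[OF linear_transition[OF cd]] tangent_spaceD(2)[OF assms cd] ..
next
  fix c assume n: "\<not> (c \<in> A \<and> p \<in> cdom c)"
  show "(a \<odot>\<^sub>t u) c = 0"
    using tangent_spaceD(1)[OF assms n] by simp
qed

lemma tzero_tangent: "tzero \<in> tangent_space A p"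
  by (rule tangent_spaceI) (simp_all add: linear_0[OF linear_transition])

lemma coord_field_add:
  "c \<in> A \<Longrightarrow> p \<in> cdom c \<Longrightarrow> coord_field c (u + v) p = coord_field c u p \<oplus>\<^sub>t coord_field c v p"
  by (rule tangent_vec_eqI[of c p]) (auto intro: coord_field_tangent tadd_tangent)

lemma coord_field_scale:
  "c \<in> A \<Longrightarrow> p \<in> cdom c \<Longrightarrow> coord_field c (a *\<^sub>R u) p = a \<odot>\<^sub>t coord_field c u p"
  by (rule tangent_vec_eqI[of c p]) (auto intro: coord_field_tangent tscale_tangent)

text \<open>The components in the chart \<open>d\<close> are a directional derivative of the
  transition map from \<open>c\<close> to \<open>d\<close>, evaluated at the image of the point
  under the inverse transition.\<close>

lemma coord_field_smooth:
  assumes "c \<in> A" "d \<in> A"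
  shows "smooth_on (coord d ` (cdom d \<inter> cdom c)) (\<lambda>x. coord_field c v (param d x) d)"
proof -
  let ?S = "coord d ` (cdom d \<inter> cdom c)" and ?T = "coord c ` (cdom c \<inter> cdom d)"
  have op: "open ?S" "open ?T" using assms open_coord_image open_cdom by auto
  have "smooth_on ?S (\<lambda>x. frechet_derivative (coord d \<circ> param c) (at ((coord c \<circ> param d) x)) v)"
  proof (rule smooth_on_compose[OF op, where h="coord c \<circ> param d"
        and h'="\<lambda>y. frechet_derivative (coord d \<circ> param c) (at y) v"])
    show "(coord c \<circ> param d) ` ?S \<subseteq> ?T" using assms by auto
    show "smooth_on ?S (coord c \<circ> param d)" using smooth_transition[OF assms(2,1)] .
    show "smooth_on ?T (\<lambda>y. frechet_derivative (coord d \<circ> param c) (at y) v)"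
      by (rule smooth_on_frechet_derivative[OF smooth_transition[OF assms]])
  qed
  then show ?thesis
    by (rule smooth_on_cong[OF op(1), rotated]) (use assms in \<open>auto simp: coord_field_def\<close>)
qed

lemma coord_field_vector_field: "c \<in> A \<Longrightarrow> coord_field c v \<in> vector_fields A (cdom c)"
  unfolding vector_fields_def using coord_field_tangent coord_field_smooth by auto

lemma vector_fieldD:
  assumes "X \<in> vector_fields A U"
  shows "p \<in> U \<Longrightarrow> X p \<in> tangent_space A p"
    and "c \<in> A \<Longrightarrow> smooth_on (coord c ` (cdom c \<inter> U)) (\<lambda>x. X (param c x) c)"
  using assms by (auto simp: vector_fields_def)

lemma vector_fields_subset: "X \<in> vector_fields A V \<Longrightarrow> U \<subseteq> V \<Longrightarrow> X \<in> vector_fields A U"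
  unfolding vector_fields_def by (auto intro: smooth_on_subset)

lemma smooth_fun_subset: "smooth_fun A V h \<Longrightarrow> U \<subseteq> V \<Longrightarrow> smooth_fun A U h"
  unfolding smooth_fun_def by (auto intro: smooth_on_subset)

lemma smooth_funD: "smooth_fun A U h \<Longrightarrow> c \<in> A \<Longrightarrow> smooth_on (coord c ` (cdom c \<inter> U)) (\<lambda>x. h (param c x))"
  by (simp add: smooth_fun_def o_def)

lemma smooth_fun_const: "open U \<Longrightarrow> smooth_fun A U (\<lambda>p. k)"
  by (simp add: smooth_fun_def o_def smooth_on_const open_coord_image)

lemma smooth_fun_mult:
  "open U \<Longrightarrow> smooth_fun A U h \<Longrightarrow> smooth_fun A U k \<Longrightarrow> smooth_fun A U (\<lambda>p. h p * k p)"
  by (simp add: smooth_fun_def o_def smooth_on_mult open_coord_image)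

lemma vector_fields_tadd:
  assumes "open U" "X \<in> vector_fields A U" "Y \<in> vector_fields A U"
  shows "(\<lambda>p. X p \<oplus>\<^sub>t Y p) \<in> vector_fields A U"
  using assms unfolding vector_fields_def
  by (simp add: tadd_tangent smooth_on_add open_coord_image)

lemma vector_fields_tscale:
  assumes "open U" "smooth_fun A U h" "X \<in> vector_fields A U"
  shows "(\<lambda>p. h p \<odot>\<^sub>t X p) \<in> vector_fields A U"
  using assms smooth_funD[OF assms(2)] unfolding vector_fields_def
  by (simp add: tscale_tangent smooth_on_scaleR open_coord_image)

lemma smooth_fun_differentiable:
  assumes "smooth_fun A U h" "p \<in> U" "c \<in> A" "p \<in> cdom c"
  shows "(h \<circ> param c) differentiable (at (coord c p))"
  using assms smooth_on_differentiable unfolding smooth_fun_def by blast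

text \<open>\<open>differential\<close> is evaluated in a chosen chart. The transformation rule of
  tangent vectors and the chain rule for the transition map compensate each other, which removes the
  choice.\<close>

lemma differential_chart:
  assumes "smooth_fun A U h" "p \<in> U" "v \<in> tangent_space A p" "c \<in> A" "p \<in> cdom c"
  shows "differential A h p v = frechet_derivative (h \<circ> param c) (at (coord c p)) (v c)"
proof -
  let ?d = "chart_at A p"
  have "v c = frechet_derivative (coord c \<circ> param ?d) (at (coord ?d p)) (v ?d)"
    using assms tangent_spaceD(2)[OF assms(3) chart_at(1) _ chart_at(2)] by blast
  then show ?thesis
    using frechet_derivative_chart_change[OF chart_at(1) assms(4) chart_at(2) assms(5)
        smooth_fun_differentiable[OF assms(1,2,4,5)]]
    by (simp add: differential_def Let_def)
qed

lemma differential_cong: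
  assumes "smooth_fun A U h" "p \<in> U" "open U" "\<And>r. r \<in> U \<Longrightarrow> h r = h' r"
  shows "differential A h' p v = differential A h p v"
proof -
  let ?c = "chart_at A p"
  have "frechet_derivative (h' \<circ> param ?c) (at (coord ?c p)) = frechet_derivative (h \<circ> param ?c) (at (coord ?c p))"
    by (rule differentiable_transform_open(2)[OF smooth_fun_differentiable[OF assms(1,2) chart_at(1,2)],
          where S="coord ?c ` (cdom ?c \<inter> U)"])
       (use assms chart_at open_coord_image in auto)
  then show ?thesis by (simp add: differential_def Let_def)
qed

lemma differential_tadd:
  assumes "smooth_fun A U h" "p \<in> U"
  shows "differential A h p (v \<oplus>\<^sub>t w) = differential A h p v + differential A h p w"
  using linear_frechet_derivative[OF smooth_fun_differentiable[OF assms chart_at(1,2)]]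
  by (simp add: differential_def Let_def linear_add)

lemma differential_tscale:
  assumes "smooth_fun A U h" "p \<in> U"
  shows "differential A h p (a \<odot>\<^sub>t v) = a * differential A h p v"
  using linear_frechet_derivative[OF smooth_fun_differentiable[OF assms chart_at(1,2)]]
  by (simp add: differential_def Let_def linear_scale)

lemma differential_const: "differential A (\<lambda>_. k) p v = 0"
  by (simp add: differential_def Let_def o_def frechet_derivative_const)

lemma differential_add:
  assumes "smooth_fun A U h" "smooth_fun A U k" "p \<in> U"
  shows "differential A (\<lambda>r. h r + k r) p v = differential A h p v + differential A k p v"
proof -
  let ?c = "chart_at A p"
  have d: "(l \<circ> param ?c has_derivative frechet_derivative (l \<circ> param ?c) (at (coord ?c p))) (at (coord ?c p))"
    if "smooth_fun A U l" for l
    using smooth_fun_differentiable[OF that assms(3) chart_at(1,2)] by (simp add: frechet_derivative_works)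
  show ?thesis
    using frechet_derivative_at[OF has_derivative_add[OF d[OF assms(1)] d[OF assms(2)]], symmetric]
    by (simp add: differential_def Let_def o_def)
qed

lemma differential_mult:
  assumes "smooth_fun A U h" "smooth_fun A U k" "p \<in> U"
  shows "differential A (\<lambda>r. h r * k r) p v = h p * differential A k p v + k p * differential A h p v"
proof -
  let ?c = "chart_at A p"
  have d: "(l \<circ> param ?c has_derivative frechet_derivative (l \<circ> param ?c) (at (coord ?c p))) (at (coord ?c p))"
    if "smooth_fun A U l" for l
    using smooth_fun_differentiable[OF that assms(3) chart_at(1,2)] by (simp add: frechet_derivative_works)
  show ?thesis
    using frechet_derivative_at[OF has_derivative_mult[OF d[OF assms(1)] d[OF assms(2)]], symmetric]
    by (simp add: differential_def Let_def o_def chart_at)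
qed

end

section \<open>Linear algebra of the metric and smoothness of the gradient\<close>

locale riemannian_manifold = manifold_atlas A
  for A :: "('a::t2_space, 'e::euclidean_space) chart set" +
  fixes g :: "('a, 'e) metric"
  assumes metric: "riemannian_metric A g"
begin

lemma metric_sym: "u \<in> tangent_space A p \<Longrightarrow> v \<in> tangent_space A p \<Longrightarrow> g p u v = g p v u"
  using metric unfolding riemannian_metric_def by blast

lemma metric_pos: "u \<in> tangent_space A p \<Longrightarrow> u \<noteq> tzero \<Longrightarrow> 0 < g p u u"
  using metric unfolding riemannian_metric_def by blast

lemma metric_combination:
  "u \<in> tangent_space A p \<Longrightarrow> v \<in> tangent_space A p \<Longrightarrow> w \<in> tangent_space A p \<Longrightarrow>
   g p (a \<odot>\<^sub>t u \<oplus>\<^sub>t b \<odot>\<^sub>t v) w = a * g p u w + b * g p v w"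
  using metric unfolding riemannian_metric_def by blast

lemma metric_smooth:
  "open U \<Longrightarrow> X \<in> vector_fields A U \<Longrightarrow> Y \<in> vector_fields A U \<Longrightarrow>
   smooth_fun A U (\<lambda>p. g p (X p) (Y p))"
  using metric unfolding riemannian_metric_def by blast

lemma metric_add_left:
  assumes "u \<in> tangent_space A p" "v \<in> tangent_space A p" "w \<in> tangent_space A p"
  shows "g p (u \<oplus>\<^sub>t v) w = g p u w + g p v w"
  using metric_combination[OF assms, of 1 1] by (simp add: tscale_def)

lemma metric_scale_left:
  assumes "u \<in> tangent_space A p" "w \<in> tangent_space A p"
  shows "g p (a \<odot>\<^sub>t u) w = a * g p u w"
  using metric_combination[OF assms(1,1,2), of a 0] by (simp add: tscale_def tadd_def)

lemma metric_add_right: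
  assumes "u \<in> tangent_space A p" "v \<in> tangent_space A p" "w \<in> tangent_space A p"
  shows "g p w (u \<oplus>\<^sub>t v) = g p w u + g p w v"
  using assms by (metis metric_sym metric_add_left tadd_tangent)

lemma metric_scale_right:
  assumes "u \<in> tangent_space A p" "w \<in> tangent_space A p"
  shows "g p w (a \<odot>\<^sub>t u) = a * g p w u"
  using assms by (metis metric_sym metric_scale_left tscale_tangent)

text \<open>Non-degeneracy: the difference of \<open>u\<close> and \<open>v\<close> is tested
  against itself. This makes the description in \<open>grad\<close> unique.\<close>

lemma metric_eqI:
  assumes "u \<in> tangent_space A p" "v \<in> tangent_space A p"
    and "\<And>w. w \<in> tangent_space A p \<Longrightarrow> g p u w = g p v w"
  shows "u = v"
proof -
  let ?z = "u \<oplus>\<^sub>t (-1) \<odot>\<^sub>t v"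
  have z: "?z \<in> tangent_space A p" by (intro tadd_tangent tscale_tangent assms)
  have "g p ?z ?z = 0"
    using assms z by (simp add: metric_add_left metric_scale_left tscale_tangent)
  then have "?z = tzero" using metric_pos[OF z] by force
  then have "?z c = tzero c" for c by simp
  then show ?thesis by (auto simp: fun_eq_iff)
qed

text \<open>In a chart the gradient solves the linear system whose matrix is the metric in the
  coordinate frame and whose right-hand side is the derivative of \<open>f\<close>. Existence at
  each point and smooth dependence on the point come out together.\<close>

lemma gradient_in_chart:
  assumes "c \<in> A" "smooth_fun A UNIV f"
  obtains G where "smooth_on (coord c ` cdom c) G"
    "\<And>p w. p \<in> cdom c \<Longrightarrow> w \<in> tangent_space A p \<Longrightarrow>
       g p (coord_field c (G (coord c p)) p) w = differential A f p w"
proof -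
  let ?S = "coord c ` cdom c"
  define a where "a x u w = g (param c x) (coord_field c u (param c x)) (coord_field c w (param c x))" for x u w
  define b where "b x w = frechet_derivative (f \<circ> param c) (at x) w" for x w
  have opS: "open ?S" using assms(1) open_coord_cdom by simp
  have f: "smooth_on ?S (f \<circ> param c)" using assms by (auto simp: smooth_fun_def)
  have "\<exists>G. smooth_on ?S G \<and> (\<forall>x\<in>?S. G x \<in> span Basis \<and> (\<forall>w\<in>span Basis. a x (G x) w = b x w))"
  proof (rule smooth_solution_posdef_span[OF finite_Basis independent_Basis opS])
    fix x u w
    assume "x \<in> ?S"
    then obtain p where p: "p \<in> cdom c" "param c x = p" using assms(1) by auto
    note T = coord_field_tangent[OF assms(1) p(1)]
    show "linear (\<lambda>u. a x u w)"
      using p T assms(1)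
      by (auto intro!: linearI simp: a_def coord_field_add coord_field_scale metric_add_left metric_scale_left)
    show "a x u w = a x w u" using T p by (simp add: a_def metric_sym)
    show "a x u u > 0" if "u \<noteq> 0"
    proof -
      have "coord_field c u p \<noteq> tzero"
        using that coord_field_self[OF assms(1) p(1), of u] by force
      then show ?thesis using metric_pos[OF T] p by (simp add: a_def)
    qed
    show "linear (b x)"
      unfolding b_def using linear_frechet_derivative[OF smooth_on_differentiable[OF f \<open>x \<in> ?S\<close>]] .
  next
    fix u w
    show "smooth_on ?S (\<lambda>x. a x u w)"
      using smooth_funD[OF metric_smooth[OF open_cdom[OF assms(1)]
          coord_field_vector_field[OF assms(1)] coord_field_vector_field[OF assms(1)]] assms(1)]
      by (simp add: a_def)
    show "smooth_on ?S (\<lambda>x. b x w)"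
      unfolding b_def by (rule smooth_on_frechet_derivative[OF f])
  qed
  then obtain G where G: "smooth_on ?S G" "\<And>x w. x \<in> ?S \<Longrightarrow> a x (G x) w = b x w"
    by auto
  show thesis
  proof (rule that[OF G(1)])
    fix p w assume p: "p \<in> cdom c" and w: "w \<in> tangent_space A p"
    have "g p (coord_field c (G (coord c p)) p) (coord_field c (w c) p) = b (coord c p) (w c)"
      using G(2)[of "coord c p" "w c"] p assms(1) by (simp add: a_def)
    then show "g p (coord_field c (G (coord c p)) p) w = differential A f p w"
      using differential_chart[OF assms(2) UNIV_I w assms(1) p] coord_field_eq[OF assms(1) p w]
      by (simp add: b_def)
  qed
qed

lemma grad_eqI:
  assumes "v \<in> tangent_space A p" "\<And>w. w \<in> tangent_space A p \<Longrightarrow> g p v w = differential A f p w"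
  shows "grad A g f p = v"
  unfolding grad_def using assms metric_eqI by (intro the_equality) auto

text \<open>Existence at a point needs one chart around it. Smoothness has to be checked in every
  chart, where uniqueness identifies the gradient with the smooth solution found in that
  chart.\<close>

lemma grad_vector_field:
  assumes "smooth_fun A UNIV f"
  shows "grad A g f \<in> vector_fields A UNIV"
proof -
  have "grad A g f p \<in> tangent_space A p" for p
  proof -
    obtain G where "\<And>w. w \<in> tangent_space A p \<Longrightarrow>
       g p (coord_field (chart_at A p) (G (coord (chart_at A p) p)) p) w = differential A f p w"
      using gradient_in_chart[OF chart_at(1) assms] chart_at(2) by metis
    then show ?thesis using grad_eqI coord_field_tangent chart_at by metis
  qed
  moreover have "smooth_on (coord c ` cdom c) (\<lambda>x. grad A g f (param c x) c)" if c: "c \<in> A" for c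
  proof -
    obtain G where G: "smooth_on (coord c ` cdom c) G"
      "\<And>p w. p \<in> cdom c \<Longrightarrow> w \<in> tangent_space A p \<Longrightarrow>
       g p (coord_field c (G (coord c p)) p) w = differential A f p w"
      using gradient_in_chart[OF c assms] by blast
    have "grad A g f p = coord_field c (G (coord c p)) p" if "p \<in> cdom c" for p
      using grad_eqI[OF coord_field_tangent[OF c that] G(2)[OF that]] .
    then show ?thesis
      by (intro smooth_on_cong[OF open_coord_cdom[OF c] _ G(1)]) (use c in auto)
  qed
  ultimately show ?thesis by (simp add: vector_fields_def)
qed

lemma grad_tangent: "smooth_fun A UNIV f \<Longrightarrow> grad A g f p \<in> tangent_space A p"
  using vector_fieldD(1)[OF grad_vector_field] by blast

lemma metric_grad:
  assumes "smooth_fun A UNIV f" "w \<in> tangent_space A p"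
  shows "g p (grad A g f p) w = differential A f p w"
proof -
  obtain G where "\<And>w. w \<in> tangent_space A p \<Longrightarrow>
       g p (coord_field (chart_at A p) (G (coord (chart_at A p) p)) p) w = differential A f p w"
    using gradient_in_chart[OF chart_at(1) assms(1)] chart_at(2) by metis
  then show ?thesis using grad_eqI coord_field_tangent chart_at assms(2) by metis
qed

lemma critical_iff_grad:
  assumes "smooth_fun A UNIV f"
  shows "p \<in> critical_points A f \<longleftrightarrow> grad A g f p = tzero"
proof
  assume "p \<in> critical_points A f"
  then show "grad A g f p = tzero"
    using metric_pos[OF grad_tangent[OF assms], of p] metric_grad[OF assms grad_tangent[OF assms], of p]
      grad_tangent[OF assms] by (force simp: critical_points_def)
next
  assume "grad A g f p = tzero"
  then have "g p (grad A g f p) w = 0" if "w \<in> tangent_space A p" for w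
    using metric_scale_left[OF tzero_tangent that, of 0] by (simp add: tscale_def tzero_def)
  then show "p \<in> critical_points A f" using metric_grad[OF assms] by (simp add: critical_points_def)
qed

end

section \<open>Non-metricity is a tensor\<close>

context manifold_atlas
begin

lemma smooth_fun_cong:
  assumes "open U" "\<And>r. r \<in> U \<Longrightarrow> h r = h' r" "smooth_fun A U h"
  shows "smooth_fun A U h'"
  unfolding smooth_fun_def
proof
  fix c assume c: "c \<in> A"
  show "smooth_on (coord c ` (cdom c \<inter> U)) (h' \<circ> param c)"
    by (rule smooth_on_cong[OF open_coord_image[OF c assms(1)] _ smooth_funD[OF assms(3) c]])
       (use assms(2) c in auto)
qed

lemma smooth_fun_from_chart:
  assumes "c \<in> A" "open U" "smooth_on (coord c ` (cdom c \<inter> U)) \<phi>"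
  shows "smooth_fun A (cdom c \<inter> U) (\<lambda>r. \<phi> (coord c r))"
  unfolding smooth_fun_def
proof
  fix d assume d: "d \<in> A"
  let ?S = "coord d ` (cdom d \<inter> (cdom c \<inter> U))"
  have op: "open (cdom c \<inter> U)" using assms(1,2) open_cdom by blast
  have "smooth_on ?S (\<lambda>x. \<phi> ((coord c \<circ> param d) x))"
  proof (rule smooth_on_compose[OF open_coord_image[OF d op] open_coord_image[OF assms(1,2)], where h'=\<phi>])
    show "(coord c \<circ> param d) ` ?S \<subseteq> coord c ` (cdom c \<inter> U)" using d by auto
    show "smooth_on ?S (coord c \<circ> param d)"
      by (rule smooth_on_subset[OF smooth_transition[OF d assms(1)]]) auto
    show "smooth_on (coord c ` (cdom c \<inter> U)) \<phi>" by (rule assms(3))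
  qed
  then show "smooth_on ?S ((\<lambda>r. \<phi> (coord c r)) \<circ> param d)" by (simp add: o_def)
qed

text \<open>The open set \<open>V\<close> and the complement of the closed set \<open>K\<close>
  cover the manifold. \<open>F\<close> is smooth over the first and zero over the second, and
  smoothness on two open sets gives smoothness on their union.\<close>

lemma smooth_on_zero_extension:
  assumes "d \<in> A" "open V" "closed K" "K \<subseteq> V"
    and "smooth_on (coord d ` (cdom d \<inter> V)) F"
    and "\<And>p. p \<in> cdom d \<Longrightarrow> p \<notin> K \<Longrightarrow> F (coord d p) = 0"
  shows "smooth_on (coord d ` cdom d) F"
proof -
  have K: "open (- K)" using assms(3) by auto
  have "smooth_on (coord d ` (cdom d \<inter> - K)) F"
    by (rule smooth_on_cong[OF open_coord_image[OF assms(1) K] _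
          smooth_on_const[OF open_coord_image[OF assms(1) K], of 0]]) (use assms(6) in auto)
  from smooth_on_Un[OF open_coord_image[OF assms(1,2)] open_coord_image[OF assms(1) K] assms(5) this]
  show ?thesis
    by (rule smooth_on_subset) (use assms(4) in auto)
qed

lemma smooth_fun_zero_extension:
  assumes "open V" "closed K" "K \<subseteq> V" "smooth_fun A V h" "\<And>p. p \<notin> K \<Longrightarrow> h p = 0"
  shows "smooth_fun A UNIV h"
  unfolding smooth_fun_def
proof
  fix d assume d: "d \<in> A"
  show "smooth_on (coord d ` (cdom d \<inter> UNIV)) (h \<circ> param d)"
    using smooth_on_zero_extension[OF d assms(1-3), of "h \<circ> param d"] assms(4,5) d
    by (simp add: smooth_fun_def)
qed

lemma vector_field_zero_extension:
  assumes "open V" "closed K" "K \<subseteq> V" "X \<in> vector_fields A V" "\<And>p. p \<notin> K \<Longrightarrow> X p = tzero"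
  shows "X \<in> vector_fields A UNIV"
proof -
  have "X p \<in> tangent_space A p" for p
  proof (cases "p \<in> V")
    case True
    then show ?thesis by (rule vector_fieldD(1)[OF assms(4)])
  next
    case False
    then have "X p = tzero" using assms(3,5) by blast
    then show ?thesis using tzero_tangent by simp
  qed
  moreover have "smooth_on (coord d ` cdom d) (\<lambda>x. X (param d x) d)" if d: "d \<in> A" for d
    using smooth_on_zero_extension[OF d assms(1-3) vector_fieldD(2)[OF assms(4) d]] assms(5) d
    by simp
  ultimately show ?thesis by (simp add: vector_fields_def)
qed

text \<open>A Euclidean bump is carried over by the chart. It vanishes off the image of a closed
  ball, which is compact and hence closed in a Hausdorff space, so its extension by zero beyond the
  chart is smooth.\<close>

lemma manifold_bump:
  assumes "open U" "p \<in> U" "c \<in> A" "p \<in> cdom c"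
  obtains \<beta> K where "closed K" "K \<subseteq> cdom c \<inter> U" "smooth_fun A UNIV \<beta>" "\<beta> p = 1"
    "\<And>r. r \<notin> K \<Longrightarrow> \<beta> r = 0"
proof -
  let ?S = "coord c ` (cdom c \<inter> U)"
  obtain e where e: "e > 0" "cball (coord c p) e \<subseteq> ?S"
    using open_coord_image[OF assms(3,1)] assms open_contains_cball by blast
  obtain \<psi> :: "'e \<Rightarrow> real" where \<psi>: "smooth_on UNIV \<psi>" "\<psi> (coord c p) = 1"
      "\<And>x. x \<notin> cball (coord c p) e \<Longrightarrow> \<psi> x = 0"
    by (rule smooth_bump[OF e(1), of "coord c p"], rule that)
  define K where "K = param c ` cball (coord c p) e"
  define \<beta> where "\<beta> r = (if r \<in> cdom c then \<psi> (coord c r) else 0)" for r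
  have "continuous_on (coord c ` cdom c) (param c)"
    using chart_homeomorphism[OF assms(3)] by (simp add: homeomorphism_def)
  then have "compact K"
    unfolding K_def
    by (rule compact_continuous_image[OF continuous_on_subset compact_cball]) (use e(2) in blast)
  then have K: "closed K" by (rule compact_imp_closed)
  have "param c ` ?S \<subseteq> cdom c \<inter> U" using assms(3) by auto
  then have KU: "K \<subseteq> cdom c \<inter> U" unfolding K_def using image_mono[OF e(2), of "param c"] by blast
  have 0: "\<beta> r = 0" if "r \<notin> K" for r
  proof (cases "r \<in> cdom c")
    case True
    then have "coord c r \<notin> cball (coord c p) e"
      using that assms(3) unfolding K_def by (metis image_eqI param_coord)
    then show ?thesis using \<psi>(3) by (simp add: \<beta>_def)
  qed (simp add: \<beta>_def)
  have op: "open (cdom c \<inter> U)" using assms(1) open_cdom[OF assms(3)] by blast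
  have "smooth_on ?S \<psi>" using \<psi>(1) by (rule smooth_on_subset) simp
  from smooth_fun_from_chart[OF assms(3,1) this] have "smooth_fun A (cdom c \<inter> U) \<beta>"
    by (rule smooth_fun_cong[OF op, rotated]) (simp add: \<beta>_def)
  from smooth_fun_zero_extension[OF op K KU this 0] have "smooth_fun A UNIV \<beta>" .
  moreover have "\<beta> p = 1" using \<psi>(2) assms(4) by (simp add: \<beta>_def)
  ultimately show thesis using 0 by (rule that[OF K KU])
qed

text \<open>With \<open>b\<close> a bump function and \<open>X\<^sup>i\<close> the components of \<open>X\<close> in the chart \<open>c\<close>, take
  \<open>\<beta> = b\<^sup>2\<close>, \<open>\<eta> i = b X\<^sup>i\<close> and \<open>Z i = b \<partial>\<^sub>i\<close>.\<close>

lemma local_frame: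
  assumes "open U" "p \<in> U"
  obtains \<beta> Z c where "smooth_fun A U \<beta>" "\<beta> p = 1" "\<And>i. Z i \<in> vector_fields A U"
    "\<And>X. X \<in> vector_fields A U \<Longrightarrow> \<exists>\<eta>. (\<forall>i. smooth_fun A U (\<eta> i) \<and> \<eta> i p = X p c \<bullet> i) \<and>
       (\<forall>r. \<beta> r \<odot>\<^sub>t X r = (\<lambda>d. \<Sum>i\<in>Basis. \<eta> i r *\<^sub>R Z i r d))"
proof -
  define c where "c = chart_at A p"
  have c: "c \<in> A" "p \<in> cdom c" using chart_at by (auto simp: c_def)
  have op: "open (cdom c \<inter> U)" using assms(1) open_cdom[OF c(1)] by blast
  obtain b K where K: "closed K" "K \<subseteq> cdom c \<inter> U"
    and b: "smooth_fun A UNIV b" "b p = 1" "\<And>r. r \<notin> K \<Longrightarrow> b r = 0"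
    using manifold_bump[OF assms c] by metis
  \<comment> \<open>One factor \<open>b\<close> extends the coordinate fields by zero beyond the
    chart and a second one extends the components of \<open>X\<close>, hence the square in front of
    \<open>X\<close> in the expansion.\<close>
  define Z where "Z i r = b r \<odot>\<^sub>t coord_field c i r" for i r
  have bsub: "smooth_fun A V b" for V using smooth_fun_subset[OF b(1)] by simp
  have "Z i \<in> vector_fields A UNIV" for i
  proof (rule vector_field_zero_extension[OF op K])
    have "(\<lambda>r. b r \<odot>\<^sub>t coord_field c i r) \<in> vector_fields A (cdom c \<inter> U)"
      by (rule vector_fields_tscale[OF op bsub
            vector_fields_subset[OF coord_field_vector_field[OF c(1)]]]) simp
    then show "Z i \<in> vector_fields A (cdom c \<inter> U)" by (simp add: Z_def[abs_def])
    show "Z i r = tzero" if "r \<notin> K" for r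
      using b(3)[OF that] by (simp add: Z_def tscale_def tzero_def)
  qed
  then have Z: "Z i \<in> vector_fields A U" for i by (rule vector_fields_subset) simp
  have "\<exists>\<eta>. (\<forall>i. smooth_fun A U (\<eta> i) \<and> \<eta> i p = X p c \<bullet> i) \<and>
       (\<forall>r. (b r * b r) \<odot>\<^sub>t X r = (\<lambda>d. \<Sum>i\<in>Basis. \<eta> i r *\<^sub>R Z i r d))"
    if X: "X \<in> vector_fields A U" for X
  proof (intro exI conjI allI)
    fix i
    let ?\<eta> = "\<lambda>i r. b r * (X r c \<bullet> i)"
    have "smooth_on (coord c ` (cdom c \<inter> U)) (\<lambda>x. X (param c x) c \<bullet> i)"
      by (rule smooth_on_bounded_linear[OF bounded_linear_inner_left open_coord_image[OF c(1) assms(1)]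
            vector_fieldD(2)[OF X c(1)]])
    from smooth_fun_from_chart[OF c(1) assms(1) this]
    have "smooth_fun A (cdom c \<inter> U) (\<lambda>r. X r c \<bullet> i)"
      by (rule smooth_fun_cong[OF op, rotated]) (use c in auto)
    then have "smooth_fun A (cdom c \<inter> U) (?\<eta> i)" by (rule smooth_fun_mult[OF op bsub])
    then have "smooth_fun A UNIV (?\<eta> i)"
      by (rule smooth_fun_zero_extension[OF op K]) (simp add: b(3))
    then show "smooth_fun A U (?\<eta> i)" by (rule smooth_fun_subset) simp
    show "?\<eta> i p = X p c \<bullet> i" by (simp add: b(2))
    fix r
    show "(b r * b r) \<odot>\<^sub>t X r = (\<lambda>d. \<Sum>i\<in>Basis. ?\<eta> i r *\<^sub>R Z i r d)"
    proof (cases "r \<in> K")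
      case False
      then show ?thesis using b(3) by (simp add: tscale_def)
    next
      case True
      then have r: "r \<in> cdom c" "r \<in> U" using K(2) by auto
      \<comment> \<open>The component at \<open>c\<close> is expanded over the standard basis and
        carried to the chart \<open>d\<close> by the linear derivative of the transition
        map.\<close>
      have "X r d = (\<Sum>i\<in>Basis. (X r c \<bullet> i) *\<^sub>R coord_field c i r d)" for d
      proof (cases "d \<in> A \<and> r \<in> cdom d")
        case True
        have lin: "linear (frechet_derivative (coord d \<circ> param c) (at (coord c r)))"
          using linear_transition True c(1) r(1) by blast
        have "X r d = frechet_derivative (coord d \<circ> param c) (at (coord c r))
            (\<Sum>i\<in>Basis. (X r c \<bullet> i) *\<^sub>R i)"
          using tangent_spaceD(2)[OF vector_fieldD(1)[OF X r(2)] c(1) _ r(1), of d] True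
          by (simp only: euclidean_representation)
        then show ?thesis
          using True by (simp add: linear_sum[OF lin] linear_scale[OF lin] coord_field_def)
      next
        case False
        then have "X r d = 0" by (rule tangent_spaceD(1)[OF vector_fieldD(1)[OF X r(2)]])
        moreover have "coord_field c i r d = 0" for i
          using False unfolding coord_field_def by presburger
        ultimately show ?thesis by simp
      qed
      note X_eq = this
      show ?thesis
      proof
        fix d
        have "((b r * b r) \<odot>\<^sub>t X r) d = (b r * b r) *\<^sub>R (\<Sum>i\<in>Basis. (X r c \<bullet> i) *\<^sub>R coord_field c i r d)"
          unfolding tscale_apply by (subst X_eq) (rule refl)
        then show "((b r * b r) \<odot>\<^sub>t X r) d = (\<Sum>i\<in>Basis. ?\<eta> i r *\<^sub>R Z i r d)"
          by (simp add: scaleR_sum_right Z_def mult_ac)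
      qed
    qed
  qed
  moreover have "smooth_fun A U (\<lambda>r. b r * b r)" by (rule smooth_fun_mult[OF assms(1) bsub bsub])
  ultimately show thesis using that[of "\<lambda>r. b r * b r" Z c] Z b(2) by simp
qed

text \<open>Multiplying \<open>X\<close> by \<open>\<beta>\<close> leaves the value of
  \<open>T\<close> unchanged because \<open>\<beta> p = 1\<close>, and the product is a finite
  combination of the fixed fields \<open>Z i\<close>. So \<open>T X\<close> is the sum of the
  components of \<open>X\<close> at \<open>p\<close> times \<open>T (Z i)\<close> and sees only the
  vector \<open>X p\<close>.\<close>

lemma tensorial_at:
  fixes T :: "('a \<Rightarrow> ('a, 'e) tvec) \<Rightarrow> real"
  assumes "open U" "p \<in> U"
    and add: "\<And>X Y. X \<in> vector_fields A U \<Longrightarrow> Y \<in> vector_fields A U \<Longrightarrow>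
      T (\<lambda>r. X r \<oplus>\<^sub>t Y r) = T X + T Y"
    and scale: "\<And>X h. X \<in> vector_fields A U \<Longrightarrow> smooth_fun A U h \<Longrightarrow>
      T (\<lambda>r. h r \<odot>\<^sub>t X r) = h p * T X"
    and X: "X \<in> vector_fields A U" and Y: "Y \<in> vector_fields A U" and "X p = Y p"
  shows "T X = T Y"
proof -
  obtain \<beta> Z c where \<beta>: "smooth_fun A U \<beta>" "\<beta> p = 1" and Z: "\<And>i. Z i \<in> vector_fields A U"
    and frame: "\<And>X. X \<in> vector_fields A U \<Longrightarrow> \<exists>\<eta>. (\<forall>i. smooth_fun A U (\<eta> i) \<and> \<eta> i p = X p c \<bullet> i) \<and>
       (\<forall>r. \<beta> r \<odot>\<^sub>t X r = (\<lambda>d. \<Sum>i\<in>Basis. \<eta> i r *\<^sub>R Z i r d))"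
    using local_frame[OF assms(1,2)] by blast
  have sum: "(\<lambda>r d. \<Sum>i\<in>I. \<eta> i r *\<^sub>R Z i r d) \<in> vector_fields A U
      \<and> T (\<lambda>r d. \<Sum>i\<in>I. \<eta> i r *\<^sub>R Z i r d) = (\<Sum>i\<in>I. \<eta> i p * T (Z i))"
    if "finite I" "\<And>i. smooth_fun A U (\<eta> i)" for I :: "'e set" and \<eta>
    using that(1)
  proof (induction I rule: finite_induct)
    case empty
    \<comment> \<open>The empty sum is the zero field; writing it as 0 times \<open>X\<close> gives
      it the value 0 by homogeneity.\<close>
    have "(\<lambda>r d. 0) = (\<lambda>r. 0 \<odot>\<^sub>t X r)" by (simp add: tscale_def)
    moreover have "(\<lambda>r. 0 \<odot>\<^sub>t X r) \<in> vector_fields A U" "T (\<lambda>r. 0 \<odot>\<^sub>t X r) = 0"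
      using vector_fields_tscale[OF assms(1) smooth_fun_const[OF assms(1)] X, of 0]
        scale[OF X smooth_fun_const[OF assms(1)], of 0] by simp_all
    ultimately show ?case by simp
  next
    case (insert i I)
    have eq: "(\<lambda>r d. \<Sum>j\<in>insert i I. \<eta> j r *\<^sub>R Z j r d)
        = (\<lambda>r. (\<eta> i r \<odot>\<^sub>t Z i r) \<oplus>\<^sub>t (\<lambda>d. \<Sum>j\<in>I. \<eta> j r *\<^sub>R Z j r d))"
      using insert.hyps by (auto simp: tadd_def tscale_def)
    show ?case
      unfolding eq
      using vector_fields_tadd[OF assms(1) vector_fields_tscale[OF assms(1) that(2) Z]] insert
        add[OF vector_fields_tscale[OF assms(1) that(2) Z]] scale[OF Z that(2)]
      by simp
  qed
  have "T V = (\<Sum>i\<in>Basis. (V p c \<bullet> i) * T (Z i))" if V: "V \<in> vector_fields A U" for V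
  proof -
    obtain \<eta> where \<eta>: "\<And>i. smooth_fun A U (\<eta> i)" "\<And>i. \<eta> i p = V p c \<bullet> i"
        "\<And>r. \<beta> r \<odot>\<^sub>t V r = (\<lambda>d. \<Sum>i\<in>Basis. \<eta> i r *\<^sub>R Z i r d)"
      using frame[OF V] by blast
    have "T V = T (\<lambda>r. \<beta> r \<odot>\<^sub>t V r)" using scale[OF V \<beta>(1)] \<beta>(2) by simp
    also have "\<dots> = (\<Sum>i\<in>Basis. \<eta> i p * T (Z i))"
      unfolding \<eta>(3) using sum[of Basis \<eta>] \<eta>(1) by simp
    finally show ?thesis by (simp add: \<eta>(2))
  qed
  from this[OF X] this[OF Y] show ?thesis using \<open>X p = Y p\<close> by simp
qed

end

section \<open>The connection and its non-metricity tensor\<close>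

locale connection_on = riemannian_manifold A g
  for A :: "('a::t2_space, 'e::euclidean_space) chart set" and g :: "('a, 'e) metric" +
  fixes U :: "'a set" and nabla :: "('a, 'e) connection"
  assumes open_U: "open U" and connection: "affine_connection A U nabla"
begin

lemma nabla_vector_field:
  "W \<in> vector_fields A U \<Longrightarrow> X \<in> vector_fields A U \<Longrightarrow> nabla W X \<in> vector_fields A U"
  using connection unfolding affine_connection_def by blast

lemma nabla_tangent:
  "W \<in> vector_fields A U \<Longrightarrow> X \<in> vector_fields A U \<Longrightarrow> p \<in> U \<Longrightarrow> nabla W X p \<in> tangent_space A p"
  using nabla_vector_field vector_fieldD(1) by blast

lemma nabla_combination:
  "W \<in> vector_fields A U \<Longrightarrow> W' \<in> vector_fields A U \<Longrightarrow> X \<in> vector_fields A U \<Longrightarrow>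
   smooth_fun A U h \<Longrightarrow> smooth_fun A U k \<Longrightarrow> p \<in> U \<Longrightarrow>
   nabla (\<lambda>r. h r \<odot>\<^sub>t W r \<oplus>\<^sub>t k r \<odot>\<^sub>t W' r) X p = h p \<odot>\<^sub>t nabla W X p \<oplus>\<^sub>t k p \<odot>\<^sub>t nabla W' X p"
  using connection unfolding affine_connection_def by blast

lemma nabla_add_right:
  "W \<in> vector_fields A U \<Longrightarrow> X \<in> vector_fields A U \<Longrightarrow> Y \<in> vector_fields A U \<Longrightarrow> p \<in> U \<Longrightarrow>
   nabla W (\<lambda>r. X r \<oplus>\<^sub>t Y r) p = nabla W X p \<oplus>\<^sub>t nabla W Y p"
  using connection unfolding affine_connection_def by blast

lemma nabla_leibniz:
  "W \<in> vector_fields A U \<Longrightarrow> X \<in> vector_fields A U \<Longrightarrow> smooth_fun A U h \<Longrightarrow> p \<in> U \<Longrightarrow>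
   nabla W (\<lambda>r. h r \<odot>\<^sub>t X r) p = differential A h p (W p) \<odot>\<^sub>t X p \<oplus>\<^sub>t h p \<odot>\<^sub>t nabla W X p"
  using connection unfolding affine_connection_def by blast

lemma nabla_add_left:
  assumes "W \<in> vector_fields A U" "W' \<in> vector_fields A U" "X \<in> vector_fields A U" "p \<in> U"
  shows "nabla (\<lambda>r. W r \<oplus>\<^sub>t W' r) X p = nabla W X p \<oplus>\<^sub>t nabla W' X p"
  using nabla_combination[OF assms(1-3) smooth_fun_const[OF open_U] smooth_fun_const[OF open_U] assms(4),
      of 1 1] by (simp add: tscale_def)

lemma nabla_scale_left:
  assumes "W \<in> vector_fields A U" "X \<in> vector_fields A U" "smooth_fun A U h" "p \<in> U"
  shows "nabla (\<lambda>r. h r \<odot>\<^sub>t W r) X p = h p \<odot>\<^sub>t nabla W X p"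
  using nabla_combination[OF assms(1,1,2,3) smooth_fun_const[OF open_U] assms(4), of 0]
  by (simp add: tscale_def tadd_def)

text \<open>A consequence of the symmetry of the metric; it reduces tensoriality in the third slot
  to that in the second.\<close>

lemma nonmetricity_field_sym:
  assumes "W \<in> vector_fields A U" "X \<in> vector_fields A U" "Y \<in> vector_fields A U" "p \<in> U"
  shows "nonmetricity_field A g nabla W X Y p = nonmetricity_field A g nabla W Y X p"
proof -
  note T = vector_fieldD(1)
  have "differential A (\<lambda>r. g r (X r) (Y r)) p (W p) = differential A (\<lambda>r. g r (Y r) (X r)) p (W p)"
    by (rule differential_cong[OF metric_smooth[OF open_U assms(3,2)] assms(4) open_U])
       (rule metric_sym[OF T[OF assms(3)] T[OF assms(2)]])
  then show ?thesis
    using metric_sym[OF nabla_tangent[OF assms(1,2,4)] T[OF assms(3,4)]]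
      metric_sym[OF nabla_tangent[OF assms(1,3,4)] T[OF assms(2,4)]]
    by (simp add: nonmetricity_field_def)
qed

lemma nonmetricity_field_cong_1:
  assumes "W \<in> vector_fields A U" "W' \<in> vector_fields A U" "X \<in> vector_fields A U"
    "Y \<in> vector_fields A U" "p \<in> U" "W p = W' p"
  shows "nonmetricity_field A g nabla W X Y p = nonmetricity_field A g nabla W' X Y p"
proof (rule tensorial_at[OF open_U assms(5) _ _ assms(1,2,6)])
  note T = vector_fieldD(1)[OF _ assms(5)]
  note sm = metric_smooth[OF open_U assms(3,4)]
  fix V assume V: "V \<in> vector_fields A U"
  note N = nabla_tangent[OF V assms(3,5)] nabla_tangent[OF V assms(4,5)]
  show "nonmetricity_field A g nabla (\<lambda>r. V r \<oplus>\<^sub>t V' r) X Y p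
    = nonmetricity_field A g nabla V X Y p + nonmetricity_field A g nabla V' X Y p"
    if V': "V' \<in> vector_fields A U" for V'
    using nabla_tangent[OF V' assms(3,5)] nabla_tangent[OF V' assms(4,5)] N
      T[OF assms(3)] T[OF assms(4)]
    by (simp add: nonmetricity_field_def nabla_add_left V V' assms differential_tadd[OF sm assms(5)]
        metric_add_left metric_add_right)
  show "nonmetricity_field A g nabla (\<lambda>r. h r \<odot>\<^sub>t V r) X Y p = h p * nonmetricity_field A g nabla V X Y p"
    if h: "smooth_fun A U h" for h
    using N T[OF assms(3)] T[OF assms(4)]
    by (simp add: nonmetricity_field_def nabla_scale_left[OF V _ h] assms differential_tscale[OF sm assms(5)]
        metric_scale_left metric_scale_right algebra_simps)
qed

text \<open>Scaling V by h produces the term dh(W) g(V, Y) twice, from differentiating h g(V, Y) and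
  from the Leibniz rule of the connection, with opposite signs. This cancellation makes the
  expression tensorial in this slot although the connection is not.\<close>

lemma nonmetricity_field_cong_2:
  assumes "W \<in> vector_fields A U" "X \<in> vector_fields A U" "X' \<in> vector_fields A U"
    "Y \<in> vector_fields A U" "p \<in> U" "X p = X' p"
  shows "nonmetricity_field A g nabla W X Y p = nonmetricity_field A g nabla W X' Y p"
proof (rule tensorial_at[OF open_U assms(5) _ _ assms(2,3,6)])
  note T = vector_fieldD(1)
  note TY = T[OF assms(4,5)]
  fix V assume V: "V \<in> vector_fields A U"
  note N = nabla_tangent[OF assms(1) V assms(5)] nabla_tangent[OF assms(1,4,5)]
  note sm = metric_smooth[OF open_U V assms(4)]
  show "nonmetricity_field A g nabla W (\<lambda>r. V r \<oplus>\<^sub>t V' r) Y p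
    = nonmetricity_field A g nabla W V Y p + nonmetricity_field A g nabla W V' Y p"
    if V': "V' \<in> vector_fields A U" for V'
  proof -
    have "differential A (\<lambda>r. g r (V r \<oplus>\<^sub>t V' r) (Y r)) p (W p)
      = differential A (\<lambda>r. g r (V r) (Y r) + g r (V' r) (Y r)) p (W p)"
      by (rule differential_cong[symmetric, OF metric_smooth[OF open_U vector_fields_tadd[OF open_U V V'] assms(4)]
            assms(5) open_U])
         (rule metric_add_left[OF T[OF V] T[OF V'] T[OF assms(4)]])
    then show ?thesis
      using N TY T[OF V assms(5)] T[OF V' assms(5)] nabla_tangent[OF assms(1) V' assms(5)]
      by (simp add: nonmetricity_field_def nabla_add_right V V' assms metric_add_left
          differential_add[OF sm metric_smooth[OF open_U V' assms(4)] assms(5)])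
  qed
  show "nonmetricity_field A g nabla W (\<lambda>r. h r \<odot>\<^sub>t V r) Y p = h p * nonmetricity_field A g nabla W V Y p"
    if h: "smooth_fun A U h" for h
  proof -
    have "differential A (\<lambda>r. g r (h r \<odot>\<^sub>t V r) (Y r)) p (W p)
      = differential A (\<lambda>r. h r * g r (V r) (Y r)) p (W p)"
      by (rule differential_cong[symmetric, OF metric_smooth[OF open_U vector_fields_tscale[OF open_U h V] assms(4)]
            assms(5) open_U])
         (rule metric_scale_left[OF T[OF V] T[OF assms(4)]])
    then show ?thesis
      using N TY T[OF V assms(5)]
      by (simp add: nonmetricity_field_def nabla_leibniz[OF assms(1) V h assms(5)] metric_add_left
          metric_scale_left tscale_tangent differential_mult[OF h sm assms(5)] algebra_simps)
  qed
qed

text \<open>The description in \<open>nonmetricity\<close> ranges over all extensions of the three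
  vectors, so it is determined once any two triples of extensions give the same value. The fields
  are exchanged one slot at a time; the third is swapped into the second slot, exchanged there and
  swapped back.\<close>

lemma nonmetricity_eq:
  assumes W: "W \<in> vector_fields A U" and X: "X \<in> vector_fields A U"
    and Y: "Y \<in> vector_fields A U" and p: "p \<in> U"
  shows "nonmetricity A g U nabla p (W p) (X p) (Y p) = nonmetricity_field A g nabla W X Y p"
proof -
  have "nonmetricity_field A g nabla W' X' Y' p = nonmetricity_field A g nabla W X Y p"
    if "W' \<in> vector_fields A U" "X' \<in> vector_fields A U" "Y' \<in> vector_fields A U"
      "W' p = W p" "X' p = X p" "Y' p = Y p" for W' X' Y'
  proof -
    have "nonmetricity_field A g nabla W' X' Y' p = nonmetricity_field A g nabla W X' Y' p"
      by (rule nonmetricity_field_cong_1) (use that W p in auto)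
    also have "\<dots> = nonmetricity_field A g nabla W X Y' p"
      by (rule nonmetricity_field_cong_2) (use that W X p in auto)
    also have "\<dots> = nonmetricity_field A g nabla W Y' X p"
      by (rule nonmetricity_field_sym) (use that W X p in auto)
    also have "\<dots> = nonmetricity_field A g nabla W Y X p"
      by (rule nonmetricity_field_cong_2) (use that W X Y p in auto)
    also have "\<dots> = nonmetricity_field A g nabla W X Y p"
      by (rule nonmetricity_field_sym) (use that W X Y p in auto)
    finally show ?thesis .
  qed
  then show ?thesis
    unfolding nonmetricity_def by (intro the_equality ballI impI) (assumption | metis W X Y)+
qed

text \<open>The field V = - grad f extends \<open>v\<close>, and the two signs in nabla_V V cancel,
  which leaves lam grad f. Its product with V is - lam g(grad f, grad f), and subtracting this for
  both connection terms gives the summand with the factor 2 lam.\<close>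

lemma nonmetricity_descent:
  assumes f: "smooth_fun A UNIV f" and p: "p \<in> U"
    and straight: "straightens A g f U nabla (\<lambda>_. lam)"
    and v: "v = (- 1) \<odot>\<^sub>t grad A g f p"
  shows "nonmetricity A g U nabla p v v v
    = differential A (\<lambda>r. g r (grad A g f r) (grad A g f r)) p v
      + 2 * lam * g p (grad A g f p) (grad A g f p)"
proof -
  let ?G = "grad A g f"
  define V where "V r = (- 1) \<odot>\<^sub>t ?G r" for r
  have G: "?G \<in> vector_fields A U" using vector_fields_subset[OF grad_vector_field[OF f]] by simp
  note c = smooth_fun_const[OF open_U, of "-1"]
  have V: "V \<in> vector_fields A U"
    using vector_fields_tscale[OF open_U c G] by (simp add: V_def[abs_def])
  note T = grad_tangent[OF f]
  have "nabla V ?G p = (- 1) \<odot>\<^sub>t nabla ?G ?G p"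
    using nabla_scale_left[OF G G c p] by (simp add: V_def[abs_def])
  moreover have "nabla ?G ?G p = lam \<odot>\<^sub>t ?G p"
    using straight p by (simp add: straightens_def)
  \<comment> \<open>The Leibniz rule for the constant factor -1, whose differential
    vanishes.\<close>
  moreover have "nabla V V p = differential A (\<lambda>r. - 1) p (V p) \<odot>\<^sub>t ?G p \<oplus>\<^sub>t (- 1) \<odot>\<^sub>t nabla V ?G p"
    using nabla_leibniz[OF V G c p] by (simp add: V_def[abs_def])
  ultimately have N: "nabla V V p = lam \<odot>\<^sub>t ?G p"
    by (simp add: differential_const tscale_def tadd_def)
  have "g r (V r) (V r) = g r (?G r) (?G r)" for r
    using T by (simp add: V_def metric_scale_left metric_scale_right tscale_tangent)
  then have "nonmetricity_field A g nabla V V V p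
    = differential A (\<lambda>r. g r (?G r) (?G r)) p (V p) + 2 * lam * g p (?G p) (?G p)"
    using T by (simp add: nonmetricity_field_def N V_def metric_scale_left metric_scale_right tscale_tangent)
  then show ?thesis using nonmetricity_eq[OF V V V p] by (simp add: v V_def)
qed

end

section \<open>Integral curves of the gradient descent\<close>

text \<open>A Gronwall argument: the derivative of |x - x0|^2 is at most 2 K |x - x0|^2, so the
  squared distance times exp(-2 K (r - a)) cannot rise above its initial value 0. The bound on
  \<open>F\<close> compares only with the rest point \<open>x0\<close>.\<close>

lemma stationary_of_linear_bound:
  fixes x :: "real \<Rightarrow> 'e::real_inner"
  assumes der: "\<And>s. s \<in> {a..b} \<Longrightarrow> (x has_vector_derivative - F s) (at s within {a..b})"
    and bound: "\<And>s. s \<in> {a..b} \<Longrightarrow> norm (F s) \<le> K * norm (x s - x0)"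
    and "x a = x0" "s \<in> {a..b}"
  shows "x s = x0"
proof (cases "s = a")
  case False
  define u where "u r = (x r - x0) \<bullet> (x r - x0) * exp (- (2 * K * (r - a)))" for r
  define u' where "u' r = (- 2 * ((x r - x0) \<bullet> F r) - 2 * K * ((x r - x0) \<bullet> (x r - x0)))
      * exp (- (2 * K * (r - a)))" for r
  have sq: "((\<lambda>r. (x r - x0) \<bullet> (x r - x0)) has_real_derivative - 2 * ((x r - x0) \<bullet> F r)) (at r within {a..b})"
    if r: "r \<in> {a..b}" for r
  proof -
    have "((\<lambda>r. x r - x0) has_derivative (\<lambda>h. h *\<^sub>R (- F r))) (at r within {a..b})"
      using has_derivative_diff[OF der[OF r, unfolded has_vector_derivative_def] has_derivative_const[of x0]]
      by simp
    from has_derivative_inner[OF this this] show ?thesis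
      unfolding has_field_derivative_def
      by (rule has_derivative_eq_rhs) (simp add: fun_eq_iff inner_commute algebra_simps)
  qed
  have u': "(u has_real_derivative u' r) (at r within {a..b})" if "r \<in> {a..b}" for r
    unfolding u_def[abs_def] u'_def
    by (rule derivative_eq_intros sq[OF that] refl)+ (simp add: algebra_simps)
  have "u' r \<le> 0" if r: "r \<in> {a..b}" for r
  proof -
    have "- ((x r - x0) \<bullet> F r) \<le> norm (x r - x0) * norm (F r)"
      using norm_cauchy_schwarz[of "x r - x0" "- F r"] by simp
    also have "\<dots> \<le> norm (x r - x0) * (K * norm (x r - x0))"
      using bound[OF r] by (rule mult_left_mono) simp
    also have "\<dots> = K * ((x r - x0) \<bullet> (x r - x0))"
      by (simp add: power2_norm_eq_inner[symmetric] power2_eq_square mult_ac)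
    finally show ?thesis unfolding u'_def by (intro mult_nonpos_nonneg) simp_all
  qed
  moreover have "\<exists>r\<in>{a<..<s}. u s - u a = u' r * (s - a)"
  proof (rule mvt_simple)
    show "a < s" using assms(4) False by simp
    show "(u has_derivative (*) (u' r)) (at r within {a..s})" if "a \<le> r" "r \<le> s" for r
      using has_field_derivative_subset[OF u', of r "{a..s}"] that assms(4)
      by (simp add: has_field_derivative_def)
  qed
  ultimately have "u s \<le> u a"
    using assms(4) by (smt (verit) atLeastAtMost_iff greaterThanLessThan_iff mult_nonpos_nonneg)
  then have "(x s - x0) \<bullet> (x s - x0) \<le> 0"
    using \<open>x a = x0\<close> by (simp add: u_def mult_le_0_iff)
  then show ?thesis by (metis inner_eq_zero_iff inner_ge_zero order_antisym right_minus_eq)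
qed (use assms in simp)

text \<open>A positive maximum of \<open>D\<close> would be a zero of \<open>h\<close> at which \<open>D\<close> has positive second
  derivative.\<close>

lemma nonpos_of_decreasing_zeros:
  fixes D h :: "real \<Rightarrow> real"
  assumes D: "\<And>t. t \<ge> 0 \<Longrightarrow> (D has_real_derivative - h t) (at t within {0..})"
    and "D 0 = 0" and lim: "(D \<longlongrightarrow> 0) at_top"
    and zero: "\<And>t. t > 0 \<Longrightarrow> D t > 0 \<Longrightarrow> h t = 0 \<Longrightarrow> \<exists>m<0. (h has_real_derivative m) (at t)"
    and "t \<ge> 0"
  shows "D t \<le> 0"
proof (rule ccontr)
  assume "\<not> D t \<le> 0"
  then have pos: "D t > 0" by simp
  have D_at: "(D has_real_derivative - h s) (at s)" if "s > 0" for s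
    using D[of s] that at_within_interior[of s "{0..}"] by simp
  \<comment> \<open>Beyond \<open>T\<close> the function stays below \<open>D t\<close>, so a
    maximum over the compact interval up to \<open>max t T\<close> is a maximum over all nonnegative
    times.\<close>
  obtain T where T: "\<And>s. s \<ge> T \<Longrightarrow> D s < D t"
    using order_tendstoD(2)[OF lim pos] by (auto simp: eventually_at_top_linorder)
  have cont: "continuous_on {0..max t T} D"
    by (rule continuous_on_subset[of "{0..}"])
       (use D in \<open>auto simp: continuous_on_eq_continuous_within intro: DERIV_continuous\<close>)
  obtain m where m: "m \<in> {0..max t T}" "\<And>s. s \<in> {0..max t T} \<Longrightarrow> D s \<le> D m"
    using continuous_attains_sup[OF compact_Icc _ cont] \<open>t \<ge> 0\<close> by fastforce
  have Dm: "D s \<le> D m" if "s \<ge> 0" for s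
  proof (cases "s \<le> max t T")
    case False
    then have "D s < D t" using T by simp
    also have "D t \<le> D m" using m(2) \<open>t \<ge> 0\<close> by simp
    finally show ?thesis by simp
  qed (use m(2) that in simp)
  have "D m > 0" using Dm[OF \<open>t \<ge> 0\<close>] pos by simp
  then have "m \<noteq> 0" using \<open>D 0 = 0\<close> by auto
  then have "m > 0" using m(1) by simp
  \<comment> \<open>The radius \<open>m\<close> keeps the comparison points at positive times, where
    \<open>m\<close> is known to be a maximum.\<close>
  have "- h m = 0"
    by (rule DERIV_local_max[OF D_at[OF \<open>m > 0\<close>] \<open>m > 0\<close>]) (use Dm in force)
  then obtain l where "l < 0" "(h has_real_derivative l) (at m)"
    using zero[OF \<open>m > 0\<close> \<open>D m > 0\<close>] by auto
  from DERIV_neg_dec_right[OF this(2,1)] obtain d where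
    d: "d > 0" "\<And>s. s > 0 \<Longrightarrow> s < d \<Longrightarrow> h (m + s) < h m" by auto
  \<comment> \<open>\<open>h\<close> is zero at \<open>m\<close> and falls strictly below zero right
    after it, so the derivative \<open>- h\<close> of \<open>D\<close> is positive there; half of
    \<open>d\<close> keeps the whole interval in range.\<close>
  have "D m < D (m + d / 2)"
  proof (rule DERIV_pos_imp_increasing_open[where f=D])
    show "m < m + d / 2" using d(1) by simp
    show "\<exists>y. DERIV D s :> y \<and> y > 0" if "m < s" "s < m + d / 2" for s
      using D_at[of s] d(2)[of "s - m"] that \<open>m > 0\<close> \<open>- h m = 0\<close> d(1) by (intro exI[of _ "- h s"]) simp
    show "continuous_on {m..m + d / 2} D"
      using DERIV_isCont[OF D_at] \<open>m > 0\<close> by (intro continuous_at_imp_continuous_on ballI) simp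
  qed
  then show False using Dm[of "m + d / 2"] \<open>m > 0\<close> d(1) by simp
qed

section \<open>Curves and smooth functions read in charts\<close>

context manifold_atlas
begin

text \<open>The second claim is needed because \<open>coord c\<close> is arbitrary outside its
  domain: \<open>param c (coord c (\<gamma> s)) = \<gamma> s\<close> may be used only for times near
  \<open>t\<close>.\<close>

lemma curve_in_chart:
  assumes "differentiable_curve A I \<gamma>" "t \<in> I" "c \<in> A" "\<gamma> t \<in> cdom c"
  shows "((coord c \<circ> \<gamma>) has_vector_derivative velocity A I \<gamma> t c) (at t within I)"
    and "\<forall>\<^sub>F s in at t within I. \<gamma> s \<in> cdom c"
proof -
  have "(coord c \<circ> \<gamma>) differentiable (at t within I)"
    using assms unfolding differentiable_curve_def by blast
  moreover have "velocity A I \<gamma> t c = vector_derivative (coord c \<circ> \<gamma>) (at t within I)"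
    using assms(3,4) by (simp add: velocity_def)
  ultimately show "((coord c \<circ> \<gamma>) has_vector_derivative velocity A I \<gamma> t c) (at t within I)"
    by (simp only: vector_derivative_works)
  have "(\<gamma> \<longlongrightarrow> \<gamma> t) (at t within I)"
    using assms(1,2) unfolding differentiable_curve_def continuous_on_def by blast
  then show "\<forall>\<^sub>F s in at t within I. \<gamma> s \<in> cdom c"
    by (rule topological_tendstoD) (use assms(3,4) open_cdom in auto)
qed

lemma smooth_fun_curve_derivative:
  assumes "differentiable_curve A I \<gamma>" "t \<in> I" "smooth_fun A UNIV h"
  shows "((\<lambda>s. h (\<gamma> s)) has_real_derivative differential A h (\<gamma> t) (velocity A I \<gamma> t)) (at t within I)"
proof -
  define c where "c = chart_at A (\<gamma> t)"
  have c: "c \<in> A" "\<gamma> t \<in> cdom c" using chart_at by (auto simp: c_def)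
  note x = curve_in_chart[OF assms(1,2) c]
  have "(h \<circ> param c has_derivative frechet_derivative (h \<circ> param c) (at (coord c (\<gamma> t))))
      (at ((coord c \<circ> \<gamma>) t))"
    using smooth_fun_differentiable[OF assms(3) UNIV_I c] by (simp add: frechet_derivative_works)
  from vector_derivative_diff_chain_within[OF x(1) has_derivative_at_withinI[OF this]]
  have "((h \<circ> param c) \<circ> (coord c \<circ> \<gamma>) has_vector_derivative
      differential A h (\<gamma> t) (velocity A I \<gamma> t)) (at t within I)"
    unfolding differential_def Let_def c_def[symmetric] .
  then have "((\<lambda>s. h (\<gamma> s)) has_vector_derivative
      differential A h (\<gamma> t) (velocity A I \<gamma> t)) (at t within I)"
    unfolding has_vector_derivative_def
    by (rule has_derivative_transform_eventually[OF _ eventually_mono[OF x(2)]])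
       (use c assms(2) in simp_all)
  then show ?thesis by (rule has_real_derivative_iff_has_vector_derivative[THEN iffD2])
qed

lemma smooth_fun_isCont:
  assumes "smooth_fun A UNIV h"
  shows "isCont h p"
proof -
  define c where "c = chart_at A p"
  have c: "c \<in> A" "p \<in> cdom c" using chart_at by (auto simp: c_def)
  have "isCont (coord c) p"
    using homeomorphism_cont1[OF chart_homeomorphism[OF c(1)]] c(2)
    by (simp add: continuous_on_eq_continuous_at[OF open_cdom[OF c(1)]])
  moreover have "isCont (h \<circ> param c) (coord c p)"
    using smooth_fun_differentiable[OF assms UNIV_I c] by (rule differentiable_imp_continuous_within)
  ultimately have "isCont ((h \<circ> param c) \<circ> coord c) p" by (rule continuous_at_compose)
  moreover have "\<forall>\<^sub>F r in nhds p. ((h \<circ> param c) \<circ> coord c) r = h r"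
    by (rule eventually_mono[OF eventually_nhds_in_open[OF open_cdom[OF c(1)] c(2)]]) (use c(1) in simp)
  from isCont_cong[OF this] calculation show ?thesis by (simp only:)
qed

end

section \<open>Descent curves that meet a critical point\<close>

context riemannian_manifold
begin

lemma descent_velocity:
  assumes "gradient_descent_curve A g f \<gamma>" "t \<ge> 0"
  shows "velocity A {0..} \<gamma> t = (- 1) \<odot>\<^sub>t grad A g f (\<gamma> t)"
  using assms by (simp add: gradient_descent_curve_def)

text \<open>In a chart the curve solves x' = - F(x) with F zero at \<open>x t\<close>.
  Differentiability of F at this one point bounds F linearly in the distance from it, and the
  Gronwall argument keeps the curve at rest as long as it is known to stay in the chart and in the
  neighbourhood of that bound.\<close>

lemma descent_locally_stationary:
  assumes f: "smooth_fun A UNIV f" and \<gamma>: "gradient_descent_curve A g f \<gamma>"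
    and "t \<ge> 0" and crit: "grad A g f (\<gamma> t) = tzero"
  obtains e where "e > 0" "\<And>s. s \<in> {t..t + e} \<Longrightarrow> \<gamma> s = \<gamma> t"
proof -
  define c where "c = chart_at A (\<gamma> t)"
  have c: "c \<in> A" "\<gamma> t \<in> cdom c" using chart_at by (auto simp: c_def)
  define F where "F x = grad A g f (param c x) c" for x
  define x where "x = coord c \<circ> \<gamma>"
  have curve: "differentiable_curve A {0..} \<gamma>" using \<gamma> by (simp add: gradient_descent_curve_def)
  have "smooth_on (coord c ` cdom c) F"
    using vector_fieldD(2)[OF grad_vector_field[OF f] c(1)] by (simp add: F_def[abs_def])
  then obtain L where L: "(F has_derivative L) (at (x t))"
    using smooth_on_differentiable c(2) unfolding x_def differentiable_def by fastforce
  have F0: "F (x t) = 0" using crit c by (simp add: F_def x_def)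
  \<comment> \<open>The derivative is used with tolerance 1; this is the summand 1 in
    \<open>K\<close> below, the other being the operator norm of the derivative.\<close>
  obtain d where d: "d > 0" "\<And>y. norm (y - x t) < d \<Longrightarrow> norm (F y - L (y - x t)) \<le> 1 * norm (y - x t)"
    using L F0 unfolding has_derivative_at_alt by (metis diff_zero zero_less_one)
  define K where "K = onorm L + 1"
  have bound: "norm (F y) \<le> K * norm (y - x t)" if "norm (y - x t) < d" for y
  proof -
    have "norm (F y) \<le> norm (F y - L (y - x t)) + norm (L (y - x t))"
      using norm_triangle_ineq[of "F y - L (y - x t)" "L (y - x t)"] by simp
    also have "\<dots> \<le> 1 * norm (y - x t) + onorm L * norm (y - x t)"
      by (rule add_mono[OF d(2)[OF that] onorm[OF has_derivative_bounded_linear[OF L]]])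
    finally show ?thesis by (simp add: K_def algebra_simps)
  qed
  have t: "t \<in> {0..}" using \<open>t \<ge> 0\<close> by simp
  have "(x has_vector_derivative velocity A {0..} \<gamma> t c) (at t within {0..})"
    unfolding x_def by (rule curve_in_chart(1)[OF curve t c])
  then have "(x \<longlongrightarrow> x t) (at t within {0..})"
    using has_vector_derivative_continuous continuous_within by blast
  then have "\<forall>\<^sub>F s in at t within {0..}. dist (x s) (x t) < d" using d(1) by (rule tendstoD)
  with curve_in_chart(2)[OF curve t c]
  have "\<forall>\<^sub>F s in at t within {0..}. \<gamma> s \<in> cdom c \<and> dist (x s) (x t) < d"
    by (rule eventually_conj)
  then obtain e where e: "e > 0" "\<And>s. s \<ge> 0 \<Longrightarrow> s \<noteq> t \<Longrightarrow> dist s t < e \<Longrightarrow> \<gamma> s \<in> cdom c \<and> dist (x s) (x t) < d"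
    unfolding eventually_at by auto
  \<comment> \<open>\<open>e\<close> bounds an open range of times; half of it gives the closed
    interval that the Gronwall argument works on.\<close>
  have near: "\<gamma> s \<in> cdom c" "norm (x s - x t) < d" if "s \<in> {t..t + e / 2}" for s
  proof -
    have "\<gamma> s \<in> cdom c \<and> dist (x s) (x t) < d"
    proof (cases "s = t")
      case False
      then show ?thesis using that \<open>t \<ge> 0\<close> e(1) by (intro e(2)) (auto simp: dist_real_def)
    qed (use c(2) d(1) in simp)
    then show "\<gamma> s \<in> cdom c" "norm (x s - x t) < d" by (simp_all add: dist_norm)
  qed
  have "x s = x t" if "s \<in> {t..t + e / 2}" for s
  proof (rule stationary_of_linear_bound[where F="\<lambda>s. F (x s)" and a=t and b="t + e / 2"])
    fix r assume r: "r \<in> {t..t + e / 2}"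
    then have r0: "r \<in> {0..}" using \<open>t \<ge> 0\<close> by simp
    have "velocity A {0..} \<gamma> r c = - F (x r)"
      using descent_velocity[OF \<gamma>, of r] r0 near(1)[OF r] c(1) by (simp add: F_def x_def)
    then have "(x has_vector_derivative - F (x r)) (at r within {0..})"
      using curve_in_chart(1)[OF curve r0 c(1) near(1)[OF r]] by (simp add: x_def)
    then show "(x has_vector_derivative - F (x r)) (at r within {t..t + e / 2})"
      by (rule has_vector_derivative_within_subset) (use \<open>t \<ge> 0\<close> in auto)
    show "norm (F (x r)) \<le> K * norm (x r - x t)" by (rule bound[OF near(2)[OF r]])
  qed (use that in auto)
  then have "\<gamma> s = \<gamma> t" if "s \<in> {t..t + e / 2}" for s
    using that near(1)[OF that] c unfolding x_def by (metis comp_apply param_coord)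
  with half_gt_zero[OF e(1)] show thesis by (rule that)
qed

text \<open>Let \<open>u\<close> be the infimum of the times at which the curve is elsewhere.
  Continuity from the left and uniqueness of limits put the curve at \<open>\<gamma> t\<close> at
  time \<open>u\<close>, and local rest carries it beyond \<open>u\<close>, against the choice of
  \<open>u\<close>.\<close>

lemma descent_stationary:
  assumes f: "smooth_fun A UNIV f" and \<gamma>: "gradient_descent_curve A g f \<gamma>"
    and "t \<ge> 0" and crit: "grad A g f (\<gamma> t) = tzero" and "s \<ge> t"
  shows "\<gamma> s = \<gamma> t"
proof (rule ccontr)
  assume "\<gamma> s \<noteq> \<gamma> t"
  define S where "S = {r. r \<ge> t \<and> \<gamma> r \<noteq> \<gamma> t}"
  define u where "u = Inf S"
  have S: "S \<noteq> {}" "bdd_below S" using \<open>\<gamma> s \<noteq> \<gamma> t\<close> \<open>s \<ge> t\<close> by (auto simp: S_def)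
  have "u \<ge> t" unfolding u_def using S(1) by (rule cInf_greatest) (simp add: S_def)
  have before: "\<gamma> r = \<gamma> t" if "t \<le> r" "r < u" for r
    using that cInf_lower[OF _ S(2), of r] unfolding u_def[symmetric] by (force simp: S_def)
  have u: "\<gamma> u = \<gamma> t"
  proof (cases "u = t")
    case False
    then have "t < u" using \<open>u \<ge> t\<close> by simp
    have "continuous_on {0..} \<gamma>"
      using \<gamma> by (simp add: gradient_descent_curve_def differentiable_curve_def)
    then have "(\<gamma> \<longlongrightarrow> \<gamma> u) (at u within {0..})"
      using \<open>t \<ge> 0\<close> \<open>u \<ge> t\<close> by (simp add: continuous_on_def)
    then have "(\<gamma> \<longlongrightarrow> \<gamma> u) (at_left u)"
      using \<open>t < u\<close> \<open>t \<ge> 0\<close> at_within_interior[of u "{0..}"] tendsto_within_subset[of \<gamma> _ u UNIV "{..<u}"]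
      by simp
    moreover have "(\<gamma> \<longlongrightarrow> \<gamma> t) (at_left u)"
      by (rule tendsto_eventually, rule eventually_mono[OF eventually_at_left_real[OF \<open>t < u\<close>]])
         (rule before, simp_all)
    ultimately show ?thesis by (rule tendsto_unique[OF trivial_limit_at_left_real])
  qed simp
  obtain e where e: "e > 0" "\<And>r. r \<in> {u..u + e} \<Longrightarrow> \<gamma> r = \<gamma> u"
  proof (rule descent_locally_stationary[OF f \<gamma>])
    show "u \<ge> 0" using \<open>t \<ge> 0\<close> \<open>u \<ge> t\<close> by simp
    show "grad A g f (\<gamma> u) = tzero" unfolding u by (rule crit)
  qed (rule that)
  have "u + e \<le> r" if "r \<in> S" for r
    using that before[of r] e(2)[of r] u by (force simp: S_def)
  then have "u + e \<le> u" unfolding u_def using S(1) by (intro cInf_greatest)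
  then show False using e(1) by simp
qed

end

section \<open>Comparison of the two descent curves\<close>

theorem theorem4p2:
  fixes A :: "('a::{t2_space, second_countable_topology}, 'e::euclidean_space) chart set"
    and g :: "('a, 'e) metric"
    and f :: "'a \<Rightarrow> real"
    and q :: 'a
    and U :: "'a set"
    and nabla :: "('a, 'e) connection"
    and lam :: real
    and \<gamma>\<^sub>1 \<gamma>\<^sub>2 :: "real \<Rightarrow> 'a"
  assumes "smooth_atlas A"
    and "riemannian_metric A g"
    and "smooth_fun A UNIV f"
    and "\<And>p. p \<noteq> q \<Longrightarrow> f q < f p"
    and "open U" and "- critical_points A f \<subseteq> U"
    and "affine_connection A U nabla"
    and "straightens A g f U nabla (\<lambda>_. lam)"
    and "gradient_descent_curve A g f \<gamma>\<^sub>1"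
    and "gradient_descent_curve A g f \<gamma>\<^sub>2"
    and "(\<gamma>\<^sub>1 \<longlongrightarrow> q) at_top"
    and "(\<gamma>\<^sub>2 \<longlongrightarrow> q) at_top"
    and "f (\<gamma>\<^sub>1 0) = f (\<gamma>\<^sub>2 0)"
    and "\<And>t. t \<ge> 0 \<Longrightarrow>
       tnorm g (\<gamma>\<^sub>1 t) (velocity A {0..} \<gamma>\<^sub>1 t) = tnorm g (\<gamma>\<^sub>2 t) (velocity A {0..} \<gamma>\<^sub>2 t) \<Longrightarrow>
       nonmetricity A g U nabla (\<gamma>\<^sub>1 t)
         (velocity A {0..} \<gamma>\<^sub>1 t) (velocity A {0..} \<gamma>\<^sub>1 t) (velocity A {0..} \<gamma>\<^sub>1 t)
       < nonmetricity A g U nabla (\<gamma>\<^sub>2 t)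
         (velocity A {0..} \<gamma>\<^sub>2 t) (velocity A {0..} \<gamma>\<^sub>2 t) (velocity A {0..} \<gamma>\<^sub>2 t)"
  shows "\<forall>t\<ge>0. f (\<gamma>\<^sub>1 t) \<le> f (\<gamma>\<^sub>2 t)"
proof -
  interpret connection_on A g U nabla
    using assms(1,2,5,7) by unfold_locales
  note f = assms(3)
  let ?G = "grad A g f"
  define E where "E p = g p (?G p) (?G p)" for p
  note T = grad_tangent[OF f]
  have E_smooth: "smooth_fun A UNIV E"
    unfolding E_def[abs_def] by (rule metric_smooth[OF open_UNIV grad_vector_field[OF f] grad_vector_field[OF f]])
  \<comment> \<open>This lets non-criticality pass from one curve to the other at times where the
    values of \<open>E\<close> agree.\<close>
  have E_pos: "E p > 0 \<longleftrightarrow> ?G p \<noteq> tzero" for p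
    using metric_pos[OF T] metric_scale_left[OF tzero_tangent tzero_tangent, where a=0 and p=p]
    by (auto simp: E_def tscale_def tzero_def)
  have norm_v: "tnorm g (\<gamma> t) (velocity A {0..} \<gamma> t) = sqrt (E (\<gamma> t))"
    if "gradient_descent_curve A g f \<gamma>" "t \<ge> 0" for \<gamma> t
    using T by (simp add: tnorm_def descent_velocity[OF that] E_def metric_scale_left metric_scale_right tscale_tangent)
  have f_der: "((\<lambda>s. f (\<gamma> s)) has_real_derivative - E (\<gamma> t)) (at t within {0..})"
    if \<gamma>: "gradient_descent_curve A g f \<gamma>" and "t \<ge> 0" for \<gamma> t
  proof -
    have "differential A f (\<gamma> t) (velocity A {0..} \<gamma> t) = - E (\<gamma> t)"
      using T by (simp add: descent_velocity[OF that] metric_grad[OF f, symmetric] tscale_tangent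
          metric_scale_right E_def)
    then show ?thesis
      using smooth_fun_curve_derivative[OF _ _ f, of "{0..}" \<gamma> t] that
      by (simp add: gradient_descent_curve_def)
  qed
  have E_der: "((\<lambda>s. E (\<gamma> s)) has_real_derivative nonmetricity A g U nabla (\<gamma> t)
         (velocity A {0..} \<gamma> t) (velocity A {0..} \<gamma> t) (velocity A {0..} \<gamma> t) - 2 * lam * E (\<gamma> t)) (at t)"
    if \<gamma>: "gradient_descent_curve A g f \<gamma>" and "t > 0" "?G (\<gamma> t) \<noteq> tzero" for \<gamma> t
  proof -
    have t: "t \<ge> 0" using \<open>t > 0\<close> by simp
    \<comment> \<open>Non-critical points lie in \<open>U\<close>, where the straightening condition
      and the axioms of the connection hold.\<close>
    have "\<gamma> t \<in> U" using assms(6) critical_iff_grad[OF f] that(3) by blast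
    then have "differential A E (\<gamma> t) (velocity A {0..} \<gamma> t) = nonmetricity A g U nabla (\<gamma> t)
         (velocity A {0..} \<gamma> t) (velocity A {0..} \<gamma> t) (velocity A {0..} \<gamma> t) - 2 * lam * E (\<gamma> t)"
      using nonmetricity_descent[OF f _ assms(8) descent_velocity[OF \<gamma> t]] by (simp add: E_def[abs_def])
    \<comment> \<open>Velocities are taken within the closed half-line; at t > 0 this is the
      two-sided derivative that the argument at a maximum requires.\<close>
    moreover have "at t within {0..} = at t" using at_within_interior[of t "{0..}"] \<open>t > 0\<close> by simp
    ultimately show ?thesis
      using smooth_fun_curve_derivative[OF _ _ E_smooth, of "{0..}" \<gamma> t] \<gamma> t
      by (simp add: gradient_descent_curve_def)
  qed
  have "f (\<gamma>\<^sub>1 t) - f (\<gamma>\<^sub>2 t) \<le> 0" if "t \<ge> 0" for t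
  proof (rule nonpos_of_decreasing_zeros[where h="\<lambda>t. E (\<gamma>\<^sub>1 t) - E (\<gamma>\<^sub>2 t)"
        and D="\<lambda>t. f (\<gamma>\<^sub>1 t) - f (\<gamma>\<^sub>2 t)"])
    show "((\<lambda>t. f (\<gamma>\<^sub>1 t) - f (\<gamma>\<^sub>2 t)) has_real_derivative - (E (\<gamma>\<^sub>1 t) - E (\<gamma>\<^sub>2 t))) (at t within {0..})"
      if "t \<ge> 0" for t
      using DERIV_diff[OF f_der[OF assms(9) that] f_der[OF assms(10) that]] by simp
    show "f (\<gamma>\<^sub>1 0) - f (\<gamma>\<^sub>2 0) = 0" using assms(13) by simp
    show "((\<lambda>t. f (\<gamma>\<^sub>1 t) - f (\<gamma>\<^sub>2 t)) \<longlongrightarrow> 0) at_top"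
      using tendsto_diff[OF isCont_tendsto_compose[OF smooth_fun_isCont[OF f] assms(11)]
          isCont_tendsto_compose[OF smooth_fun_isCont[OF f] assms(12)]] by simp
    show "t \<ge> 0" by (rule that)
    fix s :: real
    assume s: "s > 0" "f (\<gamma>\<^sub>1 s) - f (\<gamma>\<^sub>2 s) > 0" "E (\<gamma>\<^sub>1 s) - E (\<gamma>\<^sub>2 s) = 0"
    have "?G (\<gamma>\<^sub>1 s) \<noteq> tzero"
    proof
      assume "?G (\<gamma>\<^sub>1 s) = tzero"
      then have "\<gamma>\<^sub>1 r = \<gamma>\<^sub>1 s" if "r \<ge> s" for r
        using descent_stationary[OF f assms(9) _ _ that] s(1) by simp
      then have "\<forall>\<^sub>F r in at_top. \<gamma>\<^sub>1 r = \<gamma>\<^sub>1 s"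
        by (rule eventually_mono[OF eventually_ge_at_top[of s]])
      then have "(\<gamma>\<^sub>1 \<longlongrightarrow> \<gamma>\<^sub>1 s) at_top" by (rule tendsto_eventually)
      then have "\<gamma>\<^sub>1 s = q" using assms(11) tendsto_unique trivial_limit_at_top_linorder by blast
      \<comment> \<open>At \<open>q\<close> the function is minimal, so f along the first curve
        cannot exceed f along the second at time \<open>s\<close>.\<close>
      then show False using assms(4)[of "\<gamma>\<^sub>2 s"] s(2) by (cases "\<gamma>\<^sub>2 s = q") auto
    qed
    moreover from this have "?G (\<gamma>\<^sub>2 s) \<noteq> tzero"
      using E_pos[of "\<gamma>\<^sub>1 s"] E_pos[of "\<gamma>\<^sub>2 s"] s(3) by simp
    ultimately have der: "((\<lambda>t. E (\<gamma>\<^sub>1 t) - E (\<gamma>\<^sub>2 t)) has_real_derivative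
        (nonmetricity A g U nabla (\<gamma>\<^sub>1 s)
         (velocity A {0..} \<gamma>\<^sub>1 s) (velocity A {0..} \<gamma>\<^sub>1 s) (velocity A {0..} \<gamma>\<^sub>1 s) - 2 * lam * E (\<gamma>\<^sub>1 s))
        - (nonmetricity A g U nabla (\<gamma>\<^sub>2 s)
         (velocity A {0..} \<gamma>\<^sub>2 s) (velocity A {0..} \<gamma>\<^sub>2 s) (velocity A {0..} \<gamma>\<^sub>2 s) - 2 * lam * E (\<gamma>\<^sub>2 s))) (at s)"
      using s(1) by (intro DERIV_diff E_der assms(9,10))
    \<comment> \<open>Speeds are the square roots of the values of \<open>E\<close>, so equality of
      the latter is the condition under which the hypothesis compares the two tensors.\<close>
    have less: "nonmetricity A g U nabla (\<gamma>\<^sub>1 s)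
         (velocity A {0..} \<gamma>\<^sub>1 s) (velocity A {0..} \<gamma>\<^sub>1 s) (velocity A {0..} \<gamma>\<^sub>1 s)
       < nonmetricity A g U nabla (\<gamma>\<^sub>2 s)
         (velocity A {0..} \<gamma>\<^sub>2 s) (velocity A {0..} \<gamma>\<^sub>2 s) (velocity A {0..} \<gamma>\<^sub>2 s)"
      using s norm_v[OF assms(9), of s] norm_v[OF assms(10), of s] by (intro assms(14)) auto
    \<comment> \<open>The terms with the constant \<open>lam\<close> cancel because \<open>E\<close>
      agrees on the two curves; what remains is the difference of the two non-metricities, negative
      by \<open>less\<close>.\<close>
    show "\<exists>m<0. ((\<lambda>t. E (\<gamma>\<^sub>1 t) - E (\<gamma>\<^sub>2 t)) has_real_derivative m) (at s)"
      by (rule exI, rule conjI[OF _ der]) (use s(3) less in simp)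
  qed
  then show ?thesis by simp
qed

end
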